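(* Let $U_\omega$ and $A_\omega=U_\omega\times V$ be the fixed domains defined in the context. For every countably based domain $X$, $X$ is an RB-domain if and only if $[X\to A_\omega]$ is continuous. If, in addition, $X$ is pointed, then $X$ is an RB-domain if and only if $[X\to U_\omega]$ is continuous.
   Context: A domain is a nonempty continuous dcpo; directed subsets are nonempty. A dcpo is pointed if it has a least element (domains need not be pointed). A subset $B$ of a domain $X$ is a basis if for every $x\in X$ the set $\{b\in B: b\ll x\}$ is directed with supremum $x$; $X$ is countably based if it has a countable basis. $[X\to Y]$ is the dcpo of Scott-continuous maps $X\to Y$ ordered pointwise. A deflation on a domain $X$ is a Scott-continuous map $d:X\to X$ with finite image and $d\le \mathrm{id}_X$ (no idempotence is required). $X$ is an RB-domain if there is a directed family of deflations in $[X\to X]$ whose supremum is $\mathrm{id}_X$. Construction: a finite rooted order on $\mathbb N$ is a triple $\alpha=(F_\alpha,\preccurlyeq_\alpha,t_\alpha)$, where $F_\alpha$ is a nonempty finite subset of $\mathbb N$, $\preccurlyeq_\alpha$ is a partial order on $F_\alpha$, and $t_\alpha$ is its greatest element. Let $\mathcal R_\omega$ be the set of all of these. The poset $P_\omega$ has as elements a symbol $\bot_P$, the members of $\mathcal R_\omega$, and symbols $u_M$ for each finite $M\subseteq\mathbb N$ (including $M=\varnothing$). Its order: $\bot_P$ is least; $\alpha\le\beta\iff F_\alpha\subseteq F_\beta$ and $\preccurlyeq_\alpha\subseteq\preccurlyeq_\beta$ (as relations); $\alpha\le u_M\iff F_\alpha\subseteq M$; $u_M\le u_N\iff M\subseteq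 N$; there are no other comparabilities. $U_\omega=\operatorname{Idl}(P_\omega)$ is the set of nonempty directed lower subsets of $P_\omega$ ordered by inclusion. $V=\{\ell,r,\top\}$ is the three-element poset with $\ell<\top$, $r<\top$ and $\ell,r$ incomparable. $A_\omega=U_\omega\times V$ carries the componentwise order. *)

theory Defs
  imports
    "HOL-Library.Lub_Glb"
    "HOL-Library.Product_Order"
    "HOL-Library.FuncSet"
    "HOL-Library.FSet"
    "HOL-Library.Countable_Set"
begin

section \<open>Domains\<close>

text \<open>
  A poset is a set \<open>X\<close> of elements of a type of class \<open>order\<close>, with the induced order; suprema
  are always taken inside the poset, as in \<open>isLub X D s\<close> (which includes \<open>s \<in> X\<close>).
\<close>

definition directed :: "'a::order set \<Rightarrow> bool" where
  "directed D \<longleftrightarrow> D \<noteq> {} \<and> (\<forall>x\<in>D. \<forall>y\<in>D. \<exists>z\<in>D. x \<le> z \<and> y \<le> z)"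

definition dcpo :: "'a::order set \<Rightarrow> bool" where
  "dcpo X \<longleftrightarrow> (\<forall>D\<subseteq>X. directed D \<longrightarrow> (\<exists>s. isLub X D s))"

definition way_below :: "'a::order set \<Rightarrow> 'a \<Rightarrow> 'a \<Rightarrow> bool" where
  "way_below X x y \<longleftrightarrow>
     x \<in> X \<and> y \<in> X \<and> (\<forall>D\<subseteq>X. \<forall>s. directed D \<and> isLub X D s \<and> y \<le> s \<longrightarrow> (\<exists>d\<in>D. x \<le> d))"

definition is_basis :: "'a::order set \<Rightarrow> 'a set \<Rightarrow> bool" where
  "is_basis X B \<longleftrightarrow>
     B \<subseteq> X \<and> (\<forall>x\<in>X. directed {b \<in> B. way_below X b x} \<and> isLub X {b \<in> B. way_below X b x} x)"

text \<open>Continuity: every element is the directed supremum of all elements way below it.\<close>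

definition continuous_dcpo :: "'a::order set \<Rightarrow> bool" where
  "continuous_dcpo X \<longleftrightarrow> dcpo X \<and> is_basis X X"

definition is_domain :: "'a::order set \<Rightarrow> bool" where
  "is_domain X \<longleftrightarrow> X \<noteq> {} \<and> continuous_dcpo X"

definition countably_based :: "'a::order set \<Rightarrow> bool" where
  "countably_based X \<longleftrightarrow> (\<exists>B. countable B \<and> is_basis X B)"

definition pointed :: "'a::order set \<Rightarrow> bool" where
  "pointed X \<longleftrightarrow> (\<exists>b\<in>X. \<forall>x\<in>X. b \<le> x)"

text \<open>
  The poset of Scott-continuous maps. Its members are extensional (\<open>undefined\<close> outside \<open>X\<close>), so
  that the order on function types restricts to the pointwise order over \<open>X\<close>.
\<close>

definition scott_maps :: "'a::order set \<Rightarrow> 'b::order set \<Rightarrow> ('a \<Rightarrow> 'b) set" where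
  "scott_maps X Y =
     {f \<in> X \<rightarrow>\<^sub>E Y. mono_on X f \<and>
        (\<forall>D\<subseteq>X. \<forall>s. directed D \<and> isLub X D s \<longrightarrow> isLub Y (f ` D) (f s))}"

lemma scott_maps_le_iff:
  assumes "f \<in> scott_maps X Y" and "g \<in> scott_maps X Y"
  shows "f \<le> g \<longleftrightarrow> (\<forall>x\<in>X. f x \<le> g x)"
proof
  assume le: "\<forall>x\<in>X. f x \<le> g x"
  show "f \<le> g"
  proof (rule le_funI)
    fix x
    show "f x \<le> g x"
      using le assms by (cases "x \<in> X") (auto simp: scott_maps_def PiE_def extensional_def)
  qed
qed (simp add: le_fun_def)

definition deflation :: "'a::order set \<Rightarrow> ('a \<Rightarrow> 'a) \<Rightarrow> bool" where
  "deflation X d \<longleftrightarrow> d \<in> scott_maps X X \<and> finite (d ` X) \<and> (\<forall>x\<in>X. d x \<le> x)"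

definition rb_domain :: "'a::order set \<Rightarrow> bool" where
  "rb_domain X \<longleftrightarrow> is_domain X \<and>
     (\<exists>\<D>. (\<forall>d\<in>\<D>. deflation X d) \<and> directed \<D> \<and> isLub (scott_maps X X) \<D> (\<lambda>x\<in>X. x))"


section \<open>Finite rooted orders and the poset of generators\<close>

typedef rooted_order =
  "{(F :: nat set, r :: nat rel, t :: nat).
      finite F \<and> F \<noteq> {} \<and> partial_order_on F r \<and> t \<in> F \<and> (\<forall>x\<in>F. (x, t) \<in> r)}"
proof
  show "({0}, {(0, 0)}, 0) \<in> {(F :: nat set, r :: nat rel, t :: nat).
      finite F \<and> F \<noteq> {} \<and> partial_order_on F r \<and> t \<in> F \<and> (\<forall>x\<in>F. (x, t) \<in> r)}"
    by (auto simp: partial_order_on_def preorder_on_def refl_on_def trans_def antisym_def)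
qed

definition ro_carrier :: "rooted_order \<Rightarrow> nat set" where
  "ro_carrier \<alpha> = fst (Rep_rooted_order \<alpha>)"

definition ro_rel :: "rooted_order \<Rightarrow> nat rel" where
  "ro_rel \<alpha> = fst (snd (Rep_rooted_order \<alpha>))"

definition ro_top :: "rooted_order \<Rightarrow> nat" where
  "ro_top \<alpha> = snd (snd (Rep_rooted_order \<alpha>))"

lemma rooted_order_props:
  "finite (ro_carrier \<alpha>)" "ro_carrier \<alpha> \<noteq> {}" "partial_order_on (ro_carrier \<alpha>) (ro_rel \<alpha>)"
  "ro_top \<alpha> \<in> ro_carrier \<alpha>" "\<forall>x\<in>ro_carrier \<alpha>. (x, ro_top \<alpha>) \<in> ro_rel \<alpha>"
  using Rep_rooted_order[of \<alpha>] by (auto simp: ro_carrier_def ro_rel_def ro_top_def)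

lemma rooted_order_eqI:
  assumes "ro_carrier \<alpha> = ro_carrier \<beta>" and "ro_rel \<alpha> = ro_rel \<beta>"
  shows "\<alpha> = \<beta>"
proof -
  have "ro_top \<alpha> = ro_top \<beta>"
    using rooted_order_props(3-5)[of \<alpha>] rooted_order_props(4,5)[of \<beta>] assms
    by (auto simp: partial_order_on_def antisym_def)
  then show ?thesis
    using assms
    by (auto simp: ro_carrier_def ro_rel_def ro_top_def prod_eq_iff simp flip: Rep_rooted_order_inject)
qed

datatype p_omega = PBot | PRooted rooted_order | PU "nat fset"

instantiation p_omega :: order
begin

fun less_eq_p_omega :: "p_omega \<Rightarrow> p_omega \<Rightarrow> bool" where
  "PBot \<le> _ \<longleftrightarrow> True"
| "PRooted \<alpha> \<le> PRooted \<beta> \<longleftrightarrow> ro_carrier \<alpha> \<subseteq> ro_carrier \<beta> \<and> ro_rel \<alpha> \<subseteq> ro_rel \<beta>"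
| "PRooted \<alpha> \<le> PU M \<longleftrightarrow> ro_carrier \<alpha> \<subseteq> fset M"
| "PU M \<le> PU N \<longleftrightarrow> M |\<subseteq>| N"
| "PRooted _ \<le> PBot \<longleftrightarrow> False"
| "PU _ \<le> PBot \<longleftrightarrow> False"
| "PU _ \<le> PRooted _ \<longleftrightarrow> False"

definition less_p_omega :: "p_omega \<Rightarrow> p_omega \<Rightarrow> bool" where
  "x < y \<longleftrightarrow> x \<le> y \<and> \<not> y \<le> (x :: p_omega)"

instance
proof
  fix x y z :: p_omega
  show "x < y \<longleftrightarrow> x \<le> y \<and> \<not> y \<le> x"
    by (rule less_p_omega_def)
  show "x \<le> x"
    by (cases x) auto
  show "x \<le> z" if "x \<le> y" and "y \<le> z"
    using that by (cases x; cases y; cases z) (auto simp: less_eq_fset.rep_eq)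
  show "x = y" if "x \<le> y" and "y \<le> x"
    using that by (cases x; cases y) (auto intro: rooted_order_eqI)
qed

end


section \<open>The test domains\<close>

text \<open>Ideals, as sets of generators, are ordered by inclusion, the order of the set type.\<close>

definition U_omega :: "p_omega set set" where
  "U_omega = {I. directed I \<and> (\<forall>x\<in>I. \<forall>y\<le>x. y \<in> I)}"

datatype v = VL | VR | VTop

instantiation v :: order
begin

definition less_eq_v :: "v \<Rightarrow> v \<Rightarrow> bool" where
  "x \<le> y \<longleftrightarrow> x = y \<or> y = VTop"

definition less_v :: "v \<Rightarrow> v \<Rightarrow> bool" where
  "x < y \<longleftrightarrow> x \<le> y \<and> \<not> y \<le> (x :: v)"

instance
  by standard (auto simp: less_eq_v_def less_v_def)

end

text \<open>The order of the product type is the componentwise one.\<close>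

definition A_omega :: "(p_omega set \<times> v) set" where
  "A_omega = U_omega \<times> UNIV"

end

theory Submission
  imports Defs
begin

text \<open>
  If \<open>X\<close> is an RB-domain, then a Scott map \<open>f\<close> from \<open>X\<close> into any domain is the directed supremum of
  the maps \<open>g \<circ> d\<close>, where \<open>d\<close> is a deflation from the family and \<open>g\<close> is a monotone map on the finite
  image of \<open>d\<close> with \<open>g m \<ll> f m\<close> pointwise. Each of them is way below \<open>f\<close>, because on finitely many
  points \<open>m\<close> a directed family reaches \<open>g m\<close> simultaneously.

  Conversely, enumerate a countable basis and let \<open>f x\<close> be the directed poset of (indices of) basis
  elements way below \<open>x\<close>, an ideal of rooted orders. The maps sending \<open>x\<close> to the ideal generated by
  \<open>u\<^sub>M\<close>, with \<open>M\<close> the indices below \<open>n\<close> in the poset \<open>f x\<close>, have a supremum above \<open>f\<close>, so every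
  \<open>g\<close> way below \<open>f\<close> lies below one of them. Hence \<open>g x\<close> is a finite rooted order with elements below
  \<open>n\<close>, or the bottom ideal, and sending \<open>x\<close> to the root of \<open>g x\<close> is a deflation as soon as the bottom
  ideal is not taken. These deflations have supremum the identity because the maps \<open>g\<close> have supremum
  \<open>f\<close>. That some \<open>g\<close> avoids the bottom ideal follows from compactness of \<open>X\<close>, which holds if \<open>X\<close> is
  pointed and otherwise is detected by the factor \<open>v\<close>.
\<close>

section \<open>Directed suprema and the way-below relation\<close>

lemma isLub_iff:
  "isLub X D s \<longleftrightarrow> s \<in> X \<and> (\<forall>d\<in>D. d \<le> s) \<and> (\<forall>u\<in>X. (\<forall>d\<in>D. d \<le> u) \<longrightarrow> s \<le> u)"
  by (auto simp: isLub_def leastP_def isUb_def setle_def setge_def)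

lemma isLub_order_unique: "isLub X D s \<Longrightarrow> isLub X D t \<Longrightarrow> s = (t :: 'a::order)"
  by (auto simp: isLub_iff intro: antisym)

lemma directed_image:
  assumes "directed D" and "\<And>x y. x \<in> D \<Longrightarrow> y \<in> D \<Longrightarrow> x \<le> y \<Longrightarrow> f x \<le> f y"
  shows "directed (f ` D)"
  unfolding directed_def
proof (intro conjI ballI)
  show "f ` D \<noteq> {}" using assms(1) by (simp add: directed_def)
  fix u w assume "u \<in> f ` D" "w \<in> f ` D"
  then obtain x y where xy: "x \<in> D" "u = f x" "y \<in> D" "w = f y" by auto
  then obtain z where "z \<in> D" "x \<le> z" "y \<le> z" using assms(1) unfolding directed_def by blast
  then show "\<exists>v\<in>f ` D. u \<le> v \<and> w \<le> v" using xy assms(2) by auto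
qed

lemma directed_finite_bound:
  assumes "directed D" and "finite A" and "A \<subseteq> D"
  shows "\<exists>z\<in>D. \<forall>a\<in>A. a \<le> z"
  using assms(2,3)
proof (induction A rule: finite_induct)
  case empty
  then show ?case using assms(1) by (auto simp: directed_def)
next
  case (insert a A)
  then obtain z where "z \<in> D" "\<forall>b\<in>A. b \<le> z" by auto
  moreover obtain w where "w \<in> D" "z \<le> w" "a \<le> w"
    using assms(1) insert.prems \<open>z \<in> D\<close> unfolding directed_def by blast
  ultimately show ?case by (auto intro!: bexI[of _ w] intro: order_trans)
qed

text \<open>Choose a witness for each of the finitely many points and take an upper bound of them in
  \<open>D\<close>. Since persistence is only asked along members of \<open>D\<close>,
  \<open>P\<close> may itself record membership facts.\<close>

lemma directed_finite_witness:
  assumes "directed D" and "finite A" and "\<And>a. a \<in> A \<Longrightarrow> \<exists>d\<in>D. P a d"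
    and "\<And>a d e. P a d \<Longrightarrow> d \<le> e \<Longrightarrow> e \<in> D \<Longrightarrow> P a e"
  shows "\<exists>d\<in>D. \<forall>a\<in>A. P a d"
proof -
  obtain w where w: "\<And>a. a \<in> A \<Longrightarrow> w a \<in> D \<and> P a (w a)"
    using assms(3) by metis
  obtain z where "z \<in> D" "\<forall>d\<in>w ` A. d \<le> z"
    using directed_finite_bound[of D "w ` A"] assms(1,2) w by auto
  then show ?thesis using w assms(4) by blast
qed

lemma directed_above:
  assumes "directed D" and "a \<in> D"
  shows "directed {d \<in> D. a \<le> d}"
  unfolding directed_def
proof (intro conjI ballI)
  show "{d \<in> D. a \<le> d} \<noteq> {}" using assms(2) by auto
  fix x y assume xy: "x \<in> {d \<in> D. a \<le> d}" "y \<in> {d \<in> D. a \<le> d}"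
  then obtain z where "z \<in> D" "x \<le> z" "y \<le> z" using assms(1) unfolding directed_def by blast
  then show "\<exists>z\<in>{d \<in> D. a \<le> d}. x \<le> z \<and> y \<le> z" using xy by (auto intro: order_trans)
qed

lemma way_belowD:
  assumes "way_below X x y" and "D \<subseteq> X" and "directed D" and "isLub X D s" and "y \<le> s"
  obtains d where "d \<in> D" and "x \<le> d"
proof -
  have "\<exists>d\<in>D. x \<le> d"
    using assms(1)[unfolded way_below_def, THEN conjunct2, THEN conjunct2, rule_format, of D s] assms(2-5) by simp
  then show ?thesis using that by blast
qed

lemma way_below_carrier: "way_below X x y \<Longrightarrow> x \<in> X"
  by (simp add: way_below_def)

lemma way_below_trans1: "x \<in> X \<Longrightarrow> x \<le> y \<Longrightarrow> way_below X y z \<Longrightarrow> way_below X x z"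
  unfolding way_below_def by (blast intro: order_trans)

lemma way_below_trans2: "z \<in> X \<Longrightarrow> way_below X x y \<Longrightarrow> y \<le> z \<Longrightarrow> way_below X x z"
  unfolding way_below_def by (blast intro: order_trans)

lemma way_below_le: "way_below X x y \<Longrightarrow> x \<le> y"
proof -
  assume w: "way_below X x y"
  have "isLub X {y} y" "directed {y}" "{y} \<subseteq> X"
    using w by (auto simp: isLub_iff directed_def way_below_def)
  then show ?thesis using way_belowD[OF w, of "{y}" y] by auto
qed

text \<open>Each element way below \<open>x\<close> lies below a member of \<open>D\<close>, so
  \<open>D\<close> is cofinal among these elements and passes its directedness and supremum on to
  them.\<close>

lemma way_below_approximation:
  assumes "directed D" and "\<And>d. d \<in> D \<Longrightarrow> way_below X d x" and "isLub X D x"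
  shows "directed {b \<in> X. way_below X b x} \<and> isLub X {b \<in> X. way_below X b x} x"
proof
  have DX: "D \<subseteq> X" using assms(2) by (auto simp: way_below_def)
  have D: "D \<subseteq> {b \<in> X. way_below X b x}" using assms(2) DX by auto
  have *: "\<exists>d\<in>D. b \<le> d" if "way_below X b x" for b
    using way_belowD[OF that DX assms(1,3)] by auto
  have "\<exists>d\<in>D. b \<le> d \<and> c \<le> d" if "way_below X b x" "way_below X c x" for b c
    using *[OF that(1)] *[OF that(2)] assms(1) unfolding directed_def by (meson order_trans)
  then show "directed {b \<in> X. way_below X b x}"
    using D assms(1) unfolding directed_def by blast
  show "isLub X {b \<in> X. way_below X b x} x"
    unfolding isLub_iff
  proof (intro conjI ballI impI)
    show "x \<in> X" using assms(3) by (simp add: isLub_iff)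
    show "b \<le> x" if "b \<in> {b \<in> X. way_below X b x}" for b using that by (auto dest: way_below_le)
    show "x \<le> u" if "u \<in> X" "\<forall>b\<in>{b \<in> X. way_below X b x}. b \<le> u" for u
    proof -
      have "\<forall>b\<in>D. b \<le> u" using that(2) D by blast
      then show ?thesis using assms(3) that(1) by (simp add: isLub_iff)
    qed
  qed
qed

lemma continuous_dcpoI:
  assumes "dcpo X"
    and "\<And>x. x \<in> X \<Longrightarrow> \<exists>D. directed D \<and> (\<forall>d\<in>D. way_below X d x) \<and> isLub X D x"
  shows "continuous_dcpo X"
proof -
  have "directed {b \<in> X. way_below X b x} \<and> isLub X {b \<in> X. way_below X b x} x" if "x \<in> X" for x
  proof -
    obtain D where "directed D" "\<forall>d\<in>D. way_below X d x" "isLub X D x"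
      using assms(2)[OF \<open>x \<in> X\<close>] by blast
    then show ?thesis by (intro way_below_approximation) auto
  qed
  then show ?thesis using assms(1) by (simp add: continuous_dcpo_def is_basis_def)
qed

lemma continuous_dcpoD:
  assumes "continuous_dcpo X" and "x \<in> X"
  shows "directed {b \<in> X. way_below X b x}" and "isLub X {b \<in> X. way_below X b x} x"
  using assms by (auto simp: continuous_dcpo_def is_basis_def)

text \<open>Approximating \<open>x\<close> by elements \<open>z\<close>, and each \<open>z\<close>
  in turn, shows that the elements two way-below steps under \<open>x\<close> form a directed set
  with supremum \<open>x\<close>. Hence \<open>y\<close> lies below one of them.\<close>

lemma way_below_interpolate:
  assumes X: "continuous_dcpo X" and w: "way_below X y x"
  obtains z where "way_below X y z" and "way_below X z x"
proof -
  let ?S = "{v. \<exists>z. way_below X v z \<and> way_below X z x}"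
  have x: "x \<in> X" using w by (simp add: way_below_def)
  note dx = continuous_dcpoD[OF X x]
  have sub: "?S \<subseteq> X" by (auto simp: way_below_def)
  have "directed ?S"
    unfolding directed_def
  proof (intro conjI ballI)
    obtain z where z: "z \<in> X" "way_below X z x" using dx(1) by (auto simp: directed_def)
    then show "?S \<noteq> {}" using continuous_dcpoD(1)[OF X z(1)] by (auto simp: directed_def)
  next
    fix v v' assume "v \<in> ?S" "v' \<in> ?S"
    then obtain z z' where z: "way_below X v z" "way_below X z x" "way_below X v' z'" "way_below X z' x"
      by auto
    then have "z \<in> {b \<in> X. way_below X b x}" "z' \<in> {b \<in> X. way_below X b x}"
      by (auto simp: way_below_def)
    then obtain t where t: "t \<in> X" "way_below X t x" "z \<le> t" "z' \<le> t"
      using dx(1) unfolding directed_def by blast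
    then have "v \<in> {b \<in> X. way_below X b t}" "v' \<in> {b \<in> X. way_below X b t}"
      using z t(1,3,4) by (auto intro: way_below_trans2 way_below_carrier)
    then show "\<exists>u\<in>?S. v \<le> u \<and> v' \<le> u"
      using continuous_dcpoD(1)[OF X t(1)] t(2) unfolding directed_def by blast
  qed
  moreover have "isLub X ?S x"
    unfolding isLub_iff
  proof (intro conjI ballI impI)
    show "x \<in> X" by fact
    show "v \<le> x" if "v \<in> ?S" for v using that by (auto dest!: way_below_le intro: order_trans)
    fix u assume u: "u \<in> X" "\<forall>d\<in>?S. d \<le> u"
    have "z \<le> u" if z: "z \<in> X" "way_below X z x" for z
    proof -
      have "\<forall>v\<in>{b \<in> X. way_below X b z}. v \<le> u" using u(2) z(2) by blast
      then show ?thesis using continuous_dcpoD(2)[OF X z(1)] u(1) unfolding isLub_iff by blast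
    qed
    then show "x \<le> u" using dx(2) u(1) unfolding isLub_iff by blast
  qed
  ultimately obtain v where "v \<in> ?S" "y \<le> v" using way_belowD[OF w sub] by blast
  then show ?thesis using that w by (auto intro: way_below_trans1 simp: way_below_def[of X y x])
qed

lemma way_below_directed_lub:
  assumes "continuous_dcpo X" and "D \<subseteq> X" and "directed D" and "isLub X D s" and "way_below X y s"
  obtains d where "d \<in> D" and "way_below X y d"
proof -
  obtain z where z: "way_below X y z" "way_below X z s"
    using way_below_interpolate[OF assms(1,5)] by blast
  then obtain d where d: "d \<in> D" "z \<le> d" using way_belowD[OF z(2) assms(2-4)] by blast
  then show ?thesis using that z(1) assms(2) by (blast intro: way_below_trans2)
qed


section \<open>Scott-continuous maps\<close>

lemma scott_mapsD:
  assumes "f \<in> scott_maps X Y"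
  shows "x \<in> X \<Longrightarrow> f x \<in> Y" and "f \<in> extensional X"
    and "x \<in> X \<Longrightarrow> y \<in> X \<Longrightarrow> x \<le> y \<Longrightarrow> f x \<le> f y"
    and "D \<subseteq> X \<Longrightarrow> directed D \<Longrightarrow> isLub X D s \<Longrightarrow> isLub Y (f ` D) (f s)"
  using assms by (auto simp: scott_maps_def PiE_def mono_on_def)

lemma scott_mapsI:
  assumes "f \<in> extensional X" and "\<And>x. x \<in> X \<Longrightarrow> f x \<in> Y"
    and "\<And>x y. x \<in> X \<Longrightarrow> y \<in> X \<Longrightarrow> x \<le> y \<Longrightarrow> f x \<le> f y"
    and "\<And>D s u. D \<subseteq> X \<Longrightarrow> directed D \<Longrightarrow> isLub X D s \<Longrightarrow> u \<in> Y \<Longrightarrow> (\<And>d. d \<in> D \<Longrightarrow> f d \<le> u) \<Longrightarrow> f s \<le> u"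
  shows "f \<in> scott_maps X Y"
  unfolding scott_maps_def
proof (intro CollectI conjI allI impI)
  show "f \<in> X \<rightarrow>\<^sub>E Y" using assms(1,2) by (auto simp: PiE_def)
  show "mono_on X f" using assms(3) by (auto simp: mono_on_def)
  fix D s assume D: "D \<subseteq> X" and "directed D \<and> isLub X D s"
  then have d: "directed D" and s: "isLub X D s" by auto
  then show "isLub Y (f ` D) (f s)"
    using assms(2,3) assms(4)[OF D d s] D by (auto simp: isLub_iff subset_iff)
qed

lemma scott_maps_image_directed:
  "f \<in> scott_maps X Y \<Longrightarrow> D \<subseteq> X \<Longrightarrow> directed D \<Longrightarrow> directed (f ` D)"
  by (rule directed_image) (auto intro: scott_mapsD(3))

lemma finite_directed_max:
  assumes "directed D" and "finite D"
  obtains m where "m \<in> D" and "\<And>d. d \<in> D \<Longrightarrow> d \<le> m"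
  using directed_finite_bound[OF assms order_refl] by blast

text \<open>A directed set has a finite directed image under \<open>d\<close>, whose supremum
  \<open>d s\<close> is attained at some \<open>e\<close> in the set. The value at \<open>s\<close>
  therefore already occurs at \<open>e\<close>, and \<open>g\<close> has no limits to
  preserve.\<close>

lemma scott_maps_finite_comp:
  assumes "d \<in> scott_maps X X" and "finite (d ` X)"
    and "\<And>x. x \<in> d ` X \<Longrightarrow> g x \<in> Y"
    and "\<And>x y. x \<in> d ` X \<Longrightarrow> y \<in> d ` X \<Longrightarrow> x \<le> y \<Longrightarrow> g x \<le> g y"
  shows "(\<lambda>x\<in>X. g (d x)) \<in> scott_maps X Y"
proof (rule scott_mapsI)
  fix D s u assume D: "D \<subseteq> X" "directed D" "isLub X D s" and "u \<in> Y"
    and ub: "\<And>e. e \<in> D \<Longrightarrow> (\<lambda>x\<in>X. g (d x)) e \<le> u"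
  have lub: "isLub X (d ` D) (d s)" using D assms(1) by (rule scott_mapsD(4)[rotated 1])
  have "finite (d ` D)" using assms(2) D(1) by (meson finite_subset image_mono)
  then obtain m where m: "m \<in> d ` D" "\<And>y. y \<in> d ` D \<Longrightarrow> y \<le> m"
    using finite_directed_max scott_maps_image_directed assms(1) D by metis
  then have "d s \<le> m" using lub D(1) assms(1) unfolding isLub_iff by (metis imageE scott_mapsD(1) subsetD)
  moreover have "m \<le> d s" using lub m(1) unfolding isLub_iff by blast
  ultimately obtain e where "e \<in> D" "d s = d e" using m(1) by auto
  then show "(\<lambda>x\<in>X. g (d x)) s \<le> u" using ub[of e] D by (auto simp: isLub_iff)
qed (use assms in \<open>auto simp: scott_mapsD\<close>)

text \<open>Suprema of Scott maps are pointwise. That the pointwise supremum is again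
  Scott-continuous is the interchange of two suprema, here argued through common upper
  bounds.\<close>

lemma scott_maps_isLubI:
  assumes "G \<subseteq> scott_maps X Y" and "s \<in> extensional X"
    and lub: "\<And>x. x \<in> X \<Longrightarrow> isLub Y ((\<lambda>g. g x) ` G) (s x)"
  shows "isLub (scott_maps X Y) G s"
proof -
  have ub: "g x \<le> s x" if "x \<in> X" "g \<in> G" for x g
    using lub[OF that(1)] that(2) by (auto simp: isLub_iff)
  have least: "s x \<le> u" if "x \<in> X" "u \<in> Y" "\<And>g. g \<in> G \<Longrightarrow> g x \<le> u" for x u
    using lub[OF that(1)] that(2,3) by (auto simp: isLub_iff)
  have Y: "s x \<in> Y" if "x \<in> X" for x using lub[OF that] by (simp add: isLub_iff)
  have s: "s \<in> scott_maps X Y"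
  proof (rule scott_mapsI)
    fix x y assume xy: "x \<in> X" "y \<in> X" "x \<le> y"
    show "s x \<le> s y"
    proof (rule least)
      show "g x \<le> s y" if "g \<in> G" for g
        using scott_mapsD(3)[OF subsetD[OF assms(1) that] xy] ub[OF xy(2) that] by (rule order_trans)
    qed (use xy Y in auto)
  next
    fix D t u assume D: "D \<subseteq> X" "directed D" "isLub X D t" and u: "u \<in> Y" "\<And>d. d \<in> D \<Longrightarrow> s d \<le> u"
    show "s t \<le> u"
    proof (rule least)
      fix g assume g: "g \<in> G"
      have "isLub Y (g ` D) (g t)" using scott_mapsD(4) assms(1) g D by blast
      moreover have "g d \<le> u" if "d \<in> D" for d
        using ub[OF subsetD[OF D(1) that] g] u(2)[OF that] by (rule order_trans)
      ultimately show "g t \<le> u" using u(1) by (simp add: isLub_iff)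
    qed (use D u in \<open>auto simp: isLub_iff\<close>)
  qed (use assms(2) Y in auto)
  show ?thesis
    unfolding isLub_iff
  proof (intro conjI ballI impI s)
    show "g \<le> s" if "g \<in> G" for g
      using that ub s assms(1) by (subst scott_maps_le_iff) auto
    show "s \<le> u" if "u \<in> scott_maps X Y" "\<forall>g\<in>G. g \<le> u" for u
      using that least s scott_mapsD(1)[OF that(1)] by (subst scott_maps_le_iff) (auto simp: le_fun_def)
  qed
qed

lemma scott_maps_directed_at:
  "directed G \<Longrightarrow> directed ((\<lambda>g. g x) ` G)"
  by (rule directed_image) (auto simp: le_fun_def)

lemma scott_maps_lub_exists:
  assumes "dcpo Y" and "G \<subseteq> scott_maps X Y" and "directed G"
  shows "\<exists>s. isLub (scott_maps X Y) G s \<and> (\<forall>x\<in>X. isLub Y ((\<lambda>g. g x) ` G) (s x))"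
proof -
  have "\<exists>t. isLub Y ((\<lambda>g. g x) ` G) t" if "x \<in> X" for x
    using assms(1,2) scott_maps_directed_at[OF assms(3)] scott_mapsD(1) that
    unfolding dcpo_def by (metis (no_types, lifting) image_subset_iff subsetD)
  then obtain s where s: "\<And>x. x \<in> X \<Longrightarrow> isLub Y ((\<lambda>g. g x) ` G) (s x)" by metis
  have "isLub (scott_maps X Y) G (restrict s X)"
    by (rule scott_maps_isLubI) (use s assms in auto)
  then show ?thesis using s by (auto intro!: exI[of _ "restrict s X"])
qed

lemma dcpo_scott_maps: "dcpo Y \<Longrightarrow> dcpo (scott_maps X Y)"
  unfolding dcpo_def[of "scott_maps X Y"] by (metis scott_maps_lub_exists)

text \<open>The pointwise supremum is itself a least upper bound of \<open>G\<close>, so uniqueness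
  identifies it with \<open>s\<close>.\<close>

lemma scott_maps_isLub_at:
  assumes "dcpo Y" and "G \<subseteq> scott_maps X Y" and "directed G" and "isLub (scott_maps X Y) G s" and "x \<in> X"
  shows "isLub Y ((\<lambda>g. g x) ` G) (s x)"
proof -
  obtain t where t: "isLub (scott_maps X Y) G t" "\<forall>x\<in>X. isLub Y ((\<lambda>g. g x) ` G) (t x)"
    using scott_maps_lub_exists[OF assms(1-3)] by blast
  then show ?thesis using isLub_order_unique[OF assms(4)] assms(5) by auto
qed


section \<open>Function spaces out of RB-domains\<close>

text \<open>Induction on the size of \<open>M\<close>, removing a maximal point \<open>a\<close>.
  The value at \<open>a\<close> must dominate \<open>C a\<close> and the values at the points below
  \<open>a\<close>. These are finitely many elements way below \<open>f a\<close>, so directedness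
  supplies it; by maximality nothing above \<open>a\<close> constrains it.\<close>

lemma monotone_interpolant:
  assumes Y: "continuous_dcpo Y" and "finite M"
    and "\<And>m. m \<in> M \<Longrightarrow> f m \<in> Y"
    and "\<And>m n. m \<in> M \<Longrightarrow> n \<in> M \<Longrightarrow> m \<le> n \<Longrightarrow> f m \<le> f n"
    and "\<And>m. m \<in> M \<Longrightarrow> finite (C m)"
    and "\<And>m c. m \<in> M \<Longrightarrow> c \<in> C m \<Longrightarrow> way_below Y c (f m)"
  shows "\<exists>g. (\<forall>m\<in>M. way_below Y (g m) (f m) \<and> (\<forall>c\<in>C m. c \<le> g m)) \<and>
             (\<forall>m\<in>M. \<forall>n\<in>M. m \<le> n \<longrightarrow> g m \<le> g (n :: 'a::order))"
  using assms(2-)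
proof (induction "card M" arbitrary: M)
  case 0
  then show ?case by auto
next
  case (Suc k)
  then have "M \<noteq> {}" by auto
  then obtain a where a: "a \<in> M" "\<forall>m\<in>M. a \<le> m \<longrightarrow> a = m"
    using finite_has_maximal[OF Suc.prems(1)] by blast
  let ?N = "M - {a}"
  have "\<exists>g. (\<forall>m\<in>?N. way_below Y (g m) (f m) \<and> (\<forall>c\<in>C m. c \<le> g m)) \<and>
             (\<forall>m\<in>?N. \<forall>n\<in>?N. m \<le> n \<longrightarrow> g m \<le> g n)"
    by (rule Suc.hyps(1)) (use Suc.prems Suc.hyps(2) a(1) in auto)
  then obtain g where "\<forall>m\<in>?N. way_below Y (g m) (f m) \<and> (\<forall>c\<in>C m. c \<le> g m)"
    and "\<forall>m\<in>?N. \<forall>n\<in>?N. m \<le> n \<longrightarrow> g m \<le> g n"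
    by (elim exE conjE)
  then have g: "\<And>m. m \<in> ?N \<Longrightarrow> way_below Y (g m) (f m)"
    "\<And>m c. m \<in> ?N \<Longrightarrow> c \<in> C m \<Longrightarrow> c \<le> g m"
    "\<And>m n. m \<in> ?N \<Longrightarrow> n \<in> ?N \<Longrightarrow> m \<le> n \<Longrightarrow> g m \<le> g n" by simp_all
  let ?E = "C a \<union> g ` {m \<in> ?N. m \<le> a}"
  have "e \<in> {b \<in> Y. way_below Y b (f a)}" if e: "e \<in> ?E" for e
  proof -
    have "way_below Y (g m) (f a)" if m: "m \<in> ?N" "m \<le> a" for m
      by (rule way_below_trans2[OF _ g(1)[OF m(1)]]) (use Suc.prems(2,3) a(1) m in auto)
    then have "way_below Y e (f a)" using e a(1) Suc.prems(5) by auto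
    then show ?thesis by (auto dest: way_below_carrier)
  qed
  then have "\<exists>z\<in>{b \<in> Y. way_below Y b (f a)}. \<forall>e\<in>?E. e \<le> z"
    using Suc.prems(1,2,4) a(1) by (intro directed_finite_bound continuous_dcpoD(1)[OF Y]) auto
  then obtain z where z: "way_below Y z (f a)" "\<And>e. e \<in> ?E \<Longrightarrow> e \<le> z" by blast
  have mono: "(g(a := z)) m \<le> (g(a := z)) n" if mn: "m \<in> M" "n \<in> M" "m \<le> n" for m n
  proof (cases "m = a")
    case True
    then show ?thesis using a(2) mn by auto
  next
    case False
    then show ?thesis using z(2) g(3) mn by (cases "n = a") auto
  qed
  show ?case
    by (rule exI[of _ "g(a := z)"]) (use g(1,2) z mono in auto)
qed

context
  fixes X :: "'a::order set" and Y :: "'b::order set" and \<D> :: "('a \<Rightarrow> 'a) set"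
  assumes X: "is_domain X" and Y: "is_domain Y"
    and defl: "\<And>d. d \<in> \<D> \<Longrightarrow> deflation X d"
    and dir: "directed \<D>"
    and lub: "isLub (scott_maps X X) \<D> (\<lambda>x\<in>X. x)"
begin

lemma deflation_in_scott_maps: "d \<in> \<D> \<Longrightarrow> d \<in> scott_maps X X"
  using defl by (simp add: deflation_def)

lemma deflations_closed: "d \<in> \<D> \<Longrightarrow> x \<in> X \<Longrightarrow> d x \<in> X"
  using deflation_in_scott_maps by (rule scott_mapsD(1))

lemma deflations_lub_at: "x \<in> X \<Longrightarrow> isLub X ((\<lambda>d. d x) ` \<D>) x"
  using scott_maps_isLub_at[OF _ _ dir lub, of x] X deflation_in_scott_maps
  by (auto simp: is_domain_def continuous_dcpo_def)

text \<open>\<open>f\<close> carries the directed supremum of the points \<open>d x\<close> to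
  \<open>f x\<close>, and by interpolation an element way below a directed supremum is way below a
  member.\<close>

lemma way_below_scott_map_deflation:
  assumes f: "f \<in> scott_maps X Y" and w: "way_below Y y (f x)" and x: "x \<in> X"
  shows "\<exists>d\<in>\<D>. way_below Y y (f (d x))"
proof -
  let ?D = "(\<lambda>d. d x) ` \<D>"
  have D: "?D \<subseteq> X" "directed ?D"
    using deflations_closed x scott_maps_directed_at[OF dir] by auto
  have "isLub Y (f ` ?D) (f x)"
    using f D deflations_lub_at[OF x] by (rule scott_mapsD(4))
  then obtain e where "e \<in> f ` ?D" "way_below Y y e"
    using way_below_directed_lub[of Y "f ` ?D" "f x" y] Y w D
      scott_mapsD(1)[OF f] scott_maps_image_directed[OF f D]
    unfolding is_domain_def by blast
  then show ?thesis by auto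
qed

definition finite_approximants :: "('a \<Rightarrow> 'b) \<Rightarrow> ('a \<Rightarrow> 'b) set" where
  "finite_approximants f =
     {\<lambda>x\<in>X. g (d x) | g d. d \<in> \<D> \<and> (\<forall>m\<in>d ` X. way_below Y (g m) (f m)) \<and>
        (\<forall>m\<in>d ` X. \<forall>n\<in>d ` X. m \<le> n \<longrightarrow> g m \<le> g n)}"

lemma finite_approximants_image_finite:
  "p \<in> finite_approximants f \<Longrightarrow> finite (p ` X)"
proof -
  assume "p \<in> finite_approximants f"
  then obtain g d where "d \<in> \<D>" "p = (\<lambda>x\<in>X. g (d x))" by (auto simp: finite_approximants_def)
  then have "p ` X = g ` d ` X" "finite (d ` X)" using defl by (auto simp: deflation_def)
  then show ?thesis by simp
qed

lemma finite_approximants_scott: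
  "p \<in> finite_approximants f \<Longrightarrow> p \<in> scott_maps X Y"
  unfolding finite_approximants_def
  by (auto intro!: scott_maps_finite_comp dest: defl way_below_carrier simp: deflation_def)

lemma finite_approximants_way_below_at:
  assumes f: "f \<in> scott_maps X Y" and p: "p \<in> finite_approximants f" and x: "x \<in> X"
  shows "way_below Y (p x) (f x)"
proof -
  obtain g d where gd: "d \<in> \<D>" "p = (\<lambda>x\<in>X. g (d x))" "\<forall>m\<in>d ` X. way_below Y (g m) (f m)"
    using p by (auto simp: finite_approximants_def)
  then have "way_below Y (p x) (f (d x))" using x by auto
  moreover have "f (d x) \<le> f x"
    by (rule scott_mapsD(3)[OF f]) (use gd(1) x defl deflations_closed in \<open>auto simp: deflation_def\<close>)
  ultimately show ?thesis using scott_mapsD(1)[OF f x] by (blast intro: way_below_trans2)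
qed

text \<open>At each of the finitely many image points \<open>m\<close> the family \<open>H\<close>
  exceeds \<open>g m\<close>, and directedness yields one \<open>h\<close> for all of them. Then
  \<open>p x = g (d x) \<le> h (d x) \<le> h x\<close>, because \<open>d\<close> lies below the
  identity.\<close>

lemma finite_approximants_way_below:
  assumes f: "f \<in> scott_maps X Y" and p: "p \<in> finite_approximants f"
  shows "way_below (scott_maps X Y) p f"
  unfolding way_below_def
proof (intro conjI allI impI)
  show p': "p \<in> scott_maps X Y" using p by (rule finite_approximants_scott)
  show "f \<in> scott_maps X Y" by fact
  fix H s assume H: "H \<subseteq> scott_maps X Y" and "directed H \<and> isLub (scott_maps X Y) H s \<and> f \<le> s"
  then have dirH: "directed H" and s: "isLub (scott_maps X Y) H s" and le: "f \<le> s" by auto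
  obtain g d where gd: "d \<in> \<D>" "p = (\<lambda>x\<in>X. g (d x))" "\<forall>m\<in>d ` X. way_below Y (g m) (f m)"
    using p by (auto simp: finite_approximants_def)
  have fin: "finite (d ` X)" using defl[OF gd(1)] by (simp add: deflation_def)
  have "\<exists>h\<in>H. g m \<le> h m" if m: "m \<in> d ` X" for m
  proof -
    have mX: "m \<in> X" using m deflations_closed[OF gd(1)] by auto
    have "isLub Y ((\<lambda>h. h m) ` H) (s m)"
      using scott_maps_isLub_at[OF _ H dirH s mX] Y by (simp add: is_domain_def continuous_dcpo_def)
    moreover have "f m \<le> s m" using le by (simp add: le_fun_def)
    moreover have "(\<lambda>h. h m) ` H \<subseteq> Y" using H scott_mapsD(1) mX by blast
    ultimately obtain e where "e \<in> (\<lambda>h. h m) ` H" "g m \<le> e"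
      using way_belowD[of Y "g m" "f m" "(\<lambda>h. h m) ` H" "s m"] gd(3) m scott_maps_directed_at[OF dirH]
      by blast
    then show ?thesis by auto
  qed
  then have "\<exists>h\<in>H. \<forall>m\<in>d ` X. g m \<le> h m"
    using dirH fin
    by (intro directed_finite_witness) (auto simp: le_fun_def intro: order_trans)
  then obtain h where h: "h \<in> H" "\<And>m. m \<in> d ` X \<Longrightarrow> g m \<le> h m" by blast
  have "p x \<le> h x" if x: "x \<in> X" for x
  proof -
    have "h (d x) \<le> h x"
      by (rule scott_mapsD(3)[of h X Y])
        (use h(1) H gd(1) x defl deflations_closed in \<open>auto simp: deflation_def\<close>)
    then show ?thesis using h(2)[of "d x"] gd(2) x by (auto intro: order_trans)
  qed
  then show "\<exists>h\<in>H. p \<le> h" using h(1) H p' by (intro bexI[of _ h]) (auto simp: scott_maps_le_iff)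
qed

text \<open>\<open>C\<close> prescribes lower bounds at the image points. It is used with no demands
  for nonemptiness, with the values of two approximants for directedness, and with a single demand
  for the supremum.\<close>

lemma finite_approximant_above:
  assumes f: "f \<in> scott_maps X Y" and d: "d \<in> \<D>"
    and C: "\<And>m. m \<in> d ` X \<Longrightarrow> finite (C m)"
      "\<And>m c. m \<in> d ` X \<Longrightarrow> c \<in> C m \<Longrightarrow> way_below Y c (f m)"
  shows "\<exists>q\<in>finite_approximants f. \<forall>x\<in>X. \<forall>c\<in>C (d x). c \<le> q x"
proof -
  have dX: "d ` X \<subseteq> X" using deflations_closed[OF d] by auto
  have "\<exists>g. (\<forall>m\<in>d ` X. way_below Y (g m) (f m) \<and> (\<forall>c\<in>C m. c \<le> g m)) \<and>
             (\<forall>m\<in>d ` X. \<forall>n\<in>d ` X. m \<le> n \<longrightarrow> g m \<le> g n)"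
  proof (rule monotone_interpolant)
    show "continuous_dcpo Y" using Y by (simp add: is_domain_def)
    show "finite (d ` X)" using defl[OF d] by (simp add: deflation_def)
    show "f m \<in> Y" if "m \<in> d ` X" for m using scott_mapsD(1)[OF f] that dX by blast
    show "f m \<le> f n" if "m \<in> d ` X" "n \<in> d ` X" "m \<le> n" for m n
      using scott_mapsD(3)[OF f] that dX by blast
  qed (fact C)+
  then obtain g where "\<forall>m\<in>d ` X. way_below Y (g m) (f m) \<and> (\<forall>c\<in>C m. c \<le> g m)"
    and "\<forall>m\<in>d ` X. \<forall>n\<in>d ` X. m \<le> n \<longrightarrow> g m \<le> g n"
    by (elim exE conjE)
  then show ?thesis
    using d unfolding finite_approximants_def
    by (intro bexI[of _ "\<lambda>x\<in>X. g (d x)"]) auto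
qed

text \<open>Directedness needs more than \<open>p x\<close> being way below \<open>f x\<close>: a
  common upper bound is built from values way below \<open>f\<close> at image points of a new
  deflation \<open>e\<close>. Some \<open>e\<close> works at the finitely many image points of
  \<open>d\<close>, and \<open>d x \<le> x\<close> carries this over to all \<open>x\<close> and all
  larger deflations.\<close>

lemma finite_approximants_uniform:
  assumes f: "f \<in> scott_maps X Y" and p: "p \<in> finite_approximants f"
  shows "\<exists>d\<in>\<D>. \<forall>e\<in>\<D>. d \<le> e \<longrightarrow> (\<forall>x\<in>X. way_below Y (p x) (f (e x)))"
proof -
  obtain g d where gd: "d \<in> \<D>" "p = (\<lambda>x\<in>X. g (d x))" "\<forall>m\<in>d ` X. way_below Y (g m) (f m)"
    using p by (auto simp: finite_approximants_def)
  have dX: "d x \<in> X" if "x \<in> X" for x using deflations_closed[OF gd(1) that] .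
  have mono: "f (e x) \<le> f (e' x')"
    if "e \<in> \<D>" "e' \<in> \<D>" "x \<in> X" "x' \<in> X" "e \<le> e'" "x \<le> x'" for e e' x x'
  proof -
    have "e x \<le> e' x" using that(5) by (simp add: le_fun_def)
    also have "e' x \<le> e' x'" by (rule scott_mapsD(3)[OF deflation_in_scott_maps[OF that(2)] that(3,4,6)])
    finally show ?thesis
      by (rule scott_mapsD(3)[OF f deflations_closed[OF that(1,3)] deflations_closed[OF that(2,4)]])
  qed
  \<comment> \<open>The predicate carries \<open>m \<in> X\<close> and \<open>e \<in> \<D>\<close>
    along, since monotonicity in the deflation can only be applied with both at hand.\<close>
  have "\<exists>e\<in>\<D>. \<forall>m\<in>d ` X. m \<in> X \<and> e \<in> \<D> \<and> way_below Y (g m) (f (e m))"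
  proof (rule directed_finite_witness[OF dir])
    show "finite (d ` X)" using defl[OF gd(1)] by (simp add: deflation_def)
  next
    fix m assume "m \<in> d ` X"
    then have "way_below Y (g m) (f m)" "m \<in> X" using gd(3) dX by auto
    then show "\<exists>e\<in>\<D>. m \<in> X \<and> e \<in> \<D> \<and> way_below Y (g m) (f (e m))"
      using way_below_scott_map_deflation[OF f] by blast
  next
    fix m e e' assume "m \<in> X \<and> e \<in> \<D> \<and> way_below Y (g m) (f (e m))" "e \<le> e'" "e' \<in> \<D>"
    then show "m \<in> X \<and> e' \<in> \<D> \<and> way_below Y (g m) (f (e' m))"
      using mono[of e e' m m] scott_mapsD(1)[OF f deflations_closed, of e' m]
      by (auto intro: way_below_trans2)
  qed
  then obtain e where e: "e \<in> \<D>" "\<And>x. x \<in> X \<Longrightarrow> way_below Y (g (d x)) (f (e (d x)))" by auto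
  have "way_below Y (p x) (f (e' x))" if "e' \<in> \<D>" "e \<le> e'" "x \<in> X" for e' x
  proof -
    have "d x \<le> x" using defl[OF gd(1)] that(3) by (simp add: deflation_def)
    then have "f (e (d x)) \<le> f (e' x)" using mono e(1) that dX by blast
    moreover have "f (e' x) \<in> Y" using scott_mapsD(1)[OF f] deflations_closed that by blast
    ultimately show ?thesis using e(2)[OF that(3)] gd(2) that(3) by (auto intro: way_below_trans2)
  qed
  then show ?thesis using e(1) by blast
qed

lemma directed_finite_approximants:
  assumes f: "f \<in> scott_maps X Y"
  shows "directed (finite_approximants f)"
  unfolding directed_def
proof (intro conjI ballI)
  obtain d where "d \<in> \<D>" using dir by (auto simp: directed_def)
  then show "finite_approximants f \<noteq> {}"
    using finite_approximant_above[OF f, of d "\<lambda>_. {}"] by auto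
next
  fix p q assume p: "p \<in> finite_approximants f" and q: "q \<in> finite_approximants f"
  obtain d d' where d: "d \<in> \<D>" "\<forall>e\<in>\<D>. d \<le> e \<longrightarrow> (\<forall>x\<in>X. way_below Y (p x) (f (e x)))"
    and d': "d' \<in> \<D>" "\<forall>e\<in>\<D>. d' \<le> e \<longrightarrow> (\<forall>x\<in>X. way_below Y (q x) (f (e x)))"
    using finite_approximants_uniform[OF f p] finite_approximants_uniform[OF f q] by blast
  obtain e where e: "e \<in> \<D>" "d \<le> e" "d' \<le> e" using dir d(1) d'(1) unfolding directed_def by blast
  \<comment> \<open>All values of \<open>p\<close> and \<open>q\<close> on the fibre of
    \<open>e\<close> over \<open>m\<close>. An approximant through \<open>e\<close> dominating them
    at \<open>m\<close> is above both maps on that whole fibre.\<close>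
  let ?C = "\<lambda>m. p ` {x \<in> X. e x = m} \<union> q ` {x \<in> X. e x = m}"
  have fin: "finite (?C m)" for m
    by (rule finite_subset[of _ "p ` X \<union> q ` X"])
      (use finite_approximants_image_finite p q in auto)
  have pq: "way_below Y (p x) (f (e x))" "way_below Y (q x) (f (e x))" if "x \<in> X" for x
    using d(2) d'(2) e that by auto
  have "way_below Y c (f m)" if "c \<in> ?C m" for c m
    using that pq by auto
  then have "\<exists>r\<in>finite_approximants f. \<forall>x\<in>X. \<forall>c\<in>?C (e x). c \<le> r x"
    by (intro finite_approximant_above[OF f e(1) fin]) auto
  then obtain r where r: "r \<in> finite_approximants f" "\<forall>x\<in>X. \<forall>c\<in>?C (e x). c \<le> r x" by blast
  have "p \<le> r" "q \<le> r"
    using r p q finite_approximants_scott by (auto simp: scott_maps_le_iff[of _ X Y])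
  then show "\<exists>r\<in>finite_approximants f. p \<le> r \<and> q \<le> r" using r(1) by blast
qed

lemma isLub_finite_approximants:
  assumes f: "f \<in> scott_maps X Y"
  shows "isLub (scott_maps X Y) (finite_approximants f) f"
proof (rule scott_maps_isLubI)
  show "finite_approximants f \<subseteq> scott_maps X Y" using finite_approximants_scott by blast
  show "f \<in> extensional X" using f by (rule scott_mapsD(2))
  fix x assume x: "x \<in> X"
  have fx: "f x \<in> Y" using f x by (rule scott_mapsD(1))
  have Y': "continuous_dcpo Y" using Y by (simp add: is_domain_def)
  show "isLub Y ((\<lambda>g. g x) ` finite_approximants f) (f x)"
    unfolding isLub_iff
  proof (intro conjI ballI impI fx)
    show "v \<le> f x" if "v \<in> (\<lambda>g. g x) ` finite_approximants f" for v
      using that finite_approximants_way_below_at[OF f _ x] way_below_le by blast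
    fix u assume u: "u \<in> Y" "\<forall>v\<in>(\<lambda>g. g x) ` finite_approximants f. v \<le> u"
    have "y \<le> u" if y: "y \<in> {y \<in> Y. way_below Y y (f x)}" for y
    proof -
      obtain d where d: "d \<in> \<D>" "way_below Y y (f (d x))"
        using way_below_scott_map_deflation[OF f _ x, of y] y by blast
      \<comment> \<open>Only the image point \<open>d x\<close> has to reach \<open>y\<close>; the
        other points carry no demand.\<close>
      let ?C = "\<lambda>m. if m = d x then {y} else {}"
      have "\<exists>q\<in>finite_approximants f. \<forall>x\<in>X. \<forall>c\<in>?C (d x). c \<le> q x"
        by (rule finite_approximant_above[OF f d(1)]) (use d(2) in \<open>auto split: if_splits\<close>)
      then obtain q where q: "q \<in> finite_approximants f" "\<forall>x\<in>X. \<forall>c\<in>?C (d x). c \<le> q x" by blast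
      have "y \<le> q x" using q(2) x by simp
      also have "q x \<le> u" using u(2) q(1) by blast
      finally show ?thesis .
    qed
    then show "f x \<le> u" using continuous_dcpoD(2)[OF Y' fx] u(1) unfolding isLub_iff by blast
  qed
qed

end

lemma continuous_scott_maps_rb_domain:
  assumes "rb_domain X" and Y: "is_domain Y"
  shows "continuous_dcpo (scott_maps X Y)"
proof (rule continuous_dcpoI)
  show "dcpo (scott_maps X Y)" using Y by (intro dcpo_scott_maps) (simp add: is_domain_def continuous_dcpo_def)
  fix f assume f: "f \<in> scott_maps X Y"
  obtain \<D> where X: "is_domain X" and \<D>: "\<And>d. d \<in> \<D> \<Longrightarrow> deflation X d" "directed \<D>"
    "isLub (scott_maps X X) \<D> (\<lambda>x\<in>X. x)"
    using assms(1) unfolding rb_domain_def by blast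
  note facts = X Y \<D>
  show "\<exists>D. directed D \<and> (\<forall>d\<in>D. way_below (scott_maps X Y) d f) \<and> isLub (scott_maps X Y) D f"
    using directed_finite_approximants[OF facts f] finite_approximants_way_below[OF facts f]
      isLub_finite_approximants[OF facts f] by blast
qed


section \<open>The test domains\<close>

lemma isLub_Times:
  "isLub (A \<times> B) D s \<longleftrightarrow> isLub A (fst ` D) (fst s) \<and> isLub B (snd ` D) (snd s)"
proof
  assume l: "isLub (A \<times> B) D s"
  have s: "s \<in> A \<times> B" "\<And>d. d \<in> D \<Longrightarrow> d \<le> s" using l by (auto simp: isLub_iff)
  have "fst s \<le> u" if "u \<in> A" "\<forall>d\<in>fst ` D. d \<le> u" for u
  proof -
    \<comment> \<open>Completing \<open>u\<close> with the other coordinate of \<open>s\<close>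
      turns it into an upper bound in the product.\<close>
    have "\<forall>d\<in>D. d \<le> (u, snd s)" using s(2) that(2) by (auto simp: less_eq_prod_def)
    then show ?thesis using l s(1) that(1) by (auto simp: isLub_iff less_eq_prod_def)
  qed
  moreover have "snd s \<le> u" if "u \<in> B" "\<forall>d\<in>snd ` D. d \<le> u" for u
  proof -
    have "\<forall>d\<in>D. d \<le> (fst s, u)" using s(2) that(2) by (auto simp: less_eq_prod_def)
    then show ?thesis using l s(1) that(1) by (auto simp: isLub_iff less_eq_prod_def)
  qed
  ultimately show "isLub A (fst ` D) (fst s) \<and> isLub B (snd ` D) (snd s)"
    using s by (auto simp: isLub_iff less_eq_prod_def)
next
  assume "isLub A (fst ` D) (fst s) \<and> isLub B (snd ` D) (snd s)"
  then show "isLub (A \<times> B) D s" by (auto simp: isLub_iff less_eq_prod_def mem_Times_iff)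
qed

lemma directed_fst_snd:
  assumes "directed D"
  shows "directed (fst ` D)" and "directed (snd ` D)"
  using assms by (auto intro!: directed_image simp: less_eq_prod_def)

lemma way_below_Times:
  assumes "way_below A (fst x) (fst a)" and "way_below B (snd x) (snd a)"
  shows "way_below (A \<times> B) x a"
  unfolding way_below_def
proof (intro conjI allI impI)
  show "x \<in> A \<times> B" "a \<in> A \<times> B" using assms by (auto simp: way_below_def mem_Times_iff)
  fix D s assume D: "D \<subseteq> A \<times> B" and "directed D \<and> isLub (A \<times> B) D s \<and> a \<le> s"
  then have dir: "directed D" and l: "isLub A (fst ` D) (fst s)" "isLub B (snd ` D) (snd s)"
    and le: "fst a \<le> fst s" "snd a \<le> snd s"
    by (auto simp: isLub_Times less_eq_prod_def)
  have "fst ` D \<subseteq> A" "snd ` D \<subseteq> B" using D by auto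
  then obtain d e where d: "d \<in> D" "fst x \<le> fst d" and e: "e \<in> D" "snd x \<le> snd e"
    using way_belowD[OF assms(1) _ directed_fst_snd(1)[OF dir] l(1) le(1)]
      way_belowD[OF assms(2) _ directed_fst_snd(2)[OF dir] l(2) le(2)] by (metis imageE)
  then obtain c where "c \<in> D" "d \<le> c" "e \<le> c" using dir unfolding directed_def by blast
  then show "\<exists>d\<in>D. x \<le> d"
    using d e by (intro bexI[of _ c]) (auto simp: less_eq_prod_def intro: order_trans)
qed

lemma dcpo_Times:
  assumes "dcpo A" and "dcpo B"
  shows "dcpo (A \<times> B)"
  unfolding dcpo_def
proof (intro allI impI)
  fix D assume D: "D \<subseteq> A \<times> B" "directed D"
  have "fst ` D \<subseteq> A" "snd ` D \<subseteq> B" using D(1) by auto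
  then obtain s t where "isLub A (fst ` D) s" "isLub B (snd ` D) t"
    using assms directed_fst_snd[OF D(2)] unfolding dcpo_def by metis
  then have "isLub (A \<times> B) D (s, t)" by (simp add: isLub_Times)
  then show "\<exists>s. isLub (A \<times> B) D s" by blast
qed

lemma directed_Times:
  assumes "directed S" and "directed T"
  shows "directed (S \<times> T)"
  unfolding directed_def
proof (intro conjI ballI)
  show "S \<times> T \<noteq> {}" using assms by (auto simp: directed_def)
  fix x y assume xy: "x \<in> S \<times> T" "y \<in> S \<times> T"
  obtain a where "a \<in> S" "fst x \<le> a" "fst y \<le> a"
    using assms(1) xy unfolding directed_def mem_Times_iff by blast
  moreover obtain b where "b \<in> T" "snd x \<le> b" "snd y \<le> b"
    using assms(2) xy unfolding directed_def mem_Times_iff by blast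
  ultimately show "\<exists>z\<in>S \<times> T. x \<le> z \<and> y \<le> z"
    by (intro bexI[of _ "(a, b)"]) (auto simp: less_eq_prod_def)
qed

lemma is_domain_Times:
  assumes A: "is_domain A" and B: "is_domain B"
  shows "is_domain (A \<times> B)"
  unfolding is_domain_def
proof
  show "A \<times> B \<noteq> {}" using assms by (auto simp: is_domain_def)
  have A': "continuous_dcpo A" and B': "continuous_dcpo B" using assms by (auto simp: is_domain_def)
  show "continuous_dcpo (A \<times> B)"
  proof (rule continuous_dcpoI)
    show "dcpo (A \<times> B)" using A' B' by (auto intro: dcpo_Times simp: continuous_dcpo_def)
    fix x assume "x \<in> A \<times> B"
    then have x: "fst x \<in> A" "snd x \<in> B" by auto
    define S where "S = {b \<in> A. way_below A b (fst x)}"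
    define T where "T = {b \<in> B. way_below B b (snd x)}"
    have S: "directed S" "isLub A S (fst x)" and T: "directed T" "isLub B T (snd x)"
      using continuous_dcpoD[OF A' x(1)] continuous_dcpoD[OF B' x(2)] by (auto simp: S_def T_def)
    have "fst ` (S \<times> T) = S" "snd ` (S \<times> T) = T" using S(1) T(1) by (auto simp: directed_def)
    then have "isLub (A \<times> B) (S \<times> T) x" using S T by (simp add: isLub_Times)
    moreover have "\<forall>d\<in>S \<times> T. way_below (A \<times> B) d x"
      by (auto intro!: way_below_Times simp: S_def T_def)
    ultimately show "\<exists>D. directed D \<and> (\<forall>d\<in>D. way_below (A \<times> B) d x) \<and> isLub (A \<times> B) D x"
      using directed_Times[OF S(1) T(1)] by blast
  qed
qed

text \<open>Every directed subset has a greatest element, so every element is way below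
  itself.\<close>

lemma is_domain_finite:
  assumes "finite X" and "X \<noteq> {}"
  shows "is_domain X"
proof -
  have "\<exists>m\<in>D. isLub X D m" if D: "D \<subseteq> X" "directed D" for D
  proof -
    obtain m where "m \<in> D" "\<And>d. d \<in> D \<Longrightarrow> d \<le> m"
      using finite_directed_max[OF D(2)] finite_subset[OF D(1) assms(1)] by blast
    then show ?thesis using D(1) by (auto simp: isLub_iff)
  qed
  note max = this
  have compact: "way_below X x x" if x: "x \<in> X" for x
    unfolding way_below_def
  proof (intro conjI allI impI x)
    fix D s assume "D \<subseteq> X" "directed D \<and> isLub X D s \<and> x \<le> s"
    then show "\<exists>d\<in>D. x \<le> d" using max[of D] isLub_order_unique[of X D s] by auto
  qed
  have "continuous_dcpo X"
  proof (rule continuous_dcpoI)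
    show "dcpo X" using max unfolding dcpo_def by blast
    show "\<exists>D. directed D \<and> (\<forall>d\<in>D. way_below X d x) \<and> isLub X D x" if "x \<in> X" for x
      by (rule exI[of _ "{x}"]) (use compact that in \<open>auto simp: directed_def isLub_iff\<close>)
  qed
  then show ?thesis using assms(2) by (simp add: is_domain_def)
qed

lemma is_domain_v: "is_domain (UNIV :: v set)"
proof (rule is_domain_finite)
  have "(UNIV :: v set) = {VL, VR, VTop}" by (auto intro: v.exhaust)
  then show "finite (UNIV :: v set)" by (metis finite.emptyI finite_insert)
qed simp

section \<open>The ideal domain \<open>U_omega\<close>\<close>

lemma U_omegaD:
  assumes "I \<in> U_omega"
  shows "directed I" and "p \<in> I \<Longrightarrow> q \<le> p \<Longrightarrow> q \<in> I" and "PBot \<in> I"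
  using assms by (auto simp: U_omega_def directed_def)

lemma Union_in_U_omega:
  assumes "D \<subseteq> U_omega" and "directed D"
  shows "\<Union>D \<in> U_omega"
proof -
  have "directed (\<Union>D)"
    unfolding directed_def
  proof (intro conjI ballI)
    obtain I where "I \<in> D" using assms(2) by (auto simp: directed_def)
    then show "\<Union>D \<noteq> {}" using U_omegaD(3)[of I] assms(1) by auto
    fix p q assume "p \<in> \<Union>D" "q \<in> \<Union>D"
    then obtain I J where "I \<in> D" "p \<in> I" "J \<in> D" "q \<in> J" by auto
    moreover then obtain K where "K \<in> D" "I \<subseteq> K" "J \<subseteq> K" using assms(2) unfolding directed_def by blast
    ultimately have "p \<in> K" "q \<in> K" "directed K" "K \<in> D" using assms(1) U_omegaD(1) by auto
    then show "\<exists>r\<in>\<Union>D. p \<le> r \<and> q \<le> r" unfolding directed_def by blast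
  qed
  then show ?thesis using assms(1) by (auto simp: U_omega_def subset_iff)
qed

lemma isLub_U_omega_Union:
  assumes "D \<subseteq> U_omega" and "directed D"
  shows "isLub U_omega D (\<Union>D)"
  using Union_in_U_omega[OF assms] by (auto simp: isLub_iff)

lemma isLub_U_omegaD:
  "D \<subseteq> U_omega \<Longrightarrow> directed D \<Longrightarrow> isLub U_omega D s \<Longrightarrow> s = \<Union>D"
  using isLub_U_omega_Union isLub_order_unique by blast

lemma dcpo_U_omega: "dcpo U_omega"
  unfolding dcpo_def using isLub_U_omega_Union by blast

lemma principal_in_U_omega: "{q. q \<le> p} \<in> U_omega"
  by (auto simp: U_omega_def directed_def intro: order_trans)

lemma is_domain_U_omega: "is_domain U_omega"
  unfolding is_domain_def
proof
  show "U_omega \<noteq> {}" using principal_in_U_omega by blast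
  show "continuous_dcpo U_omega"
  proof (rule continuous_dcpoI[OF dcpo_U_omega])
    fix I assume I: "I \<in> U_omega"
    let ?D = "(\<lambda>p. {q. q \<le> p}) ` I"
    have D: "?D \<subseteq> U_omega" using principal_in_U_omega by blast
    have dir: "directed ?D" using U_omegaD(1)[OF I] by (rule directed_image) auto
    have "\<Union>?D = I" using U_omegaD(2)[OF I] by auto
    then have "isLub U_omega ?D I" using isLub_U_omega_Union[OF D dir] by simp
    \<comment> \<open>Directed suprema of ideals are unions, so some member contains
      \<open>p\<close>, and with it everything below \<open>p\<close>.\<close>
    moreover have "way_below U_omega {q. q \<le> p} I" if p: "p \<in> I" for p
      unfolding way_below_def
    proof (intro conjI allI impI I principal_in_U_omega)
      fix E s assume E: "E \<subseteq> U_omega" and s: "directed E \<and> isLub U_omega E s \<and> I \<subseteq> s"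
      then have "p \<in> \<Union>E" using isLub_U_omegaD[OF E] p by blast
      then show "\<exists>J\<in>E. {q. q \<le> p} \<subseteq> J" using U_omegaD(2) E by blast
    qed
    ultimately show "\<exists>D. directed D \<and> (\<forall>d\<in>D. way_below U_omega d I) \<and> isLub U_omega D I"
      using dir by blast
  qed
qed

lemma is_domain_A_omega: "is_domain A_omega"
  unfolding A_omega_def using is_domain_U_omega is_domain_v by (rule is_domain_Times)

section \<open>Rooted orders and supports of generators\<close>

lemma ro_rel_carrier: "ro_rel \<alpha> \<subseteq> ro_carrier \<alpha> \<times> ro_carrier \<alpha>"
  using rooted_order_props(3)[of \<alpha>] by (simp add: partial_order_on_def preorder_on_def)

lemma rooted_order_exists:
  assumes "finite F" and "partial_order_on F r" and "t \<in> F" and "\<forall>x\<in>F. (x, t) \<in> r"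
  obtains \<alpha> where "ro_carrier \<alpha> = F" and "ro_rel \<alpha> = r"
proof
  have "Rep_rooted_order (Abs_rooted_order (F, r, t)) = (F, r, t)"
    by (rule Abs_rooted_order_inverse) (use assms in auto)
  then show "ro_carrier (Abs_rooted_order (F, r, t)) = F" "ro_rel (Abs_rooted_order (F, r, t)) = r"
    by (auto simp: ro_carrier_def ro_rel_def)
qed

text \<open>The root is determined by the order, so carrier and relation together embed these rooted
  orders into a finite set.\<close>

lemma finite_rooted_orders: "finite M \<Longrightarrow> finite {\<alpha>. ro_carrier \<alpha> \<subseteq> M}"
proof (rule inj_on_finite)
  show "inj_on (\<lambda>\<alpha>. (ro_carrier \<alpha>, ro_rel \<alpha>)) {\<alpha>. ro_carrier \<alpha> \<subseteq> M}"
    by (auto intro: inj_onI rooted_order_eqI)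
  show "(\<lambda>\<alpha>. (ro_carrier \<alpha>, ro_rel \<alpha>)) ` {\<alpha>. ro_carrier \<alpha> \<subseteq> M} \<subseteq> Pow M \<times> Pow (M \<times> M)"
    using ro_rel_carrier by fastforce
qed simp

text \<open>The support of a generator is the least \<open>M\<close> for which it lies below the
  generator \<open>PU M\<close>.\<close>

fun p_support :: "p_omega \<Rightarrow> nat set" where
  "p_support PBot = {}"
| "p_support (PRooted \<alpha>) = ro_carrier \<alpha>"
| "p_support (PU M) = fset M"

lemma finite_p_support: "finite (p_support p)"
  by (cases p) (auto simp: rooted_order_props)

lemma p_support_mono: "p \<le> q \<Longrightarrow> p_support p \<subseteq> p_support q"
  by (cases p; cases q) (auto simp: less_eq_fset.rep_eq)

lemma p_support_le_PU: "p_support p \<subseteq> fset M \<Longrightarrow> p \<le> PU M"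
  by (cases p) (auto simp: less_eq_fset.rep_eq)

text \<open>For finite \<open>M\<close> this is the principal ideal of the generator
  \<open>PU M\<close>; for infinite \<open>M\<close> it is the union of those of its finite
  subsets.\<close>

definition saturated_ideal :: "nat set \<Rightarrow> p_omega set" where
  "saturated_ideal M = {p. p_support p \<subseteq> M}"

lemma saturated_ideal_in_U_omega: "saturated_ideal M \<in> U_omega"
proof -
  have "directed (saturated_ideal M)"
    unfolding directed_def
  proof (intro conjI ballI)
    have "PBot \<in> saturated_ideal M" by (simp add: saturated_ideal_def)
    then show "saturated_ideal M \<noteq> {}" by auto
    fix p q assume pq: "p \<in> saturated_ideal M" "q \<in> saturated_ideal M"
    obtain N where N: "fset N = p_support p \<union> p_support q"
      using finite_p_support[of p] finite_p_support[of q] by (metis finite_UnI fset_cases mem_Collect_eq)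
    then have "p \<le> PU N" "q \<le> PU N" "PU N \<in> saturated_ideal M"
      using pq by (auto intro!: p_support_le_PU simp: saturated_ideal_def)
    then show "\<exists>r\<in>saturated_ideal M. p \<le> r \<and> q \<le> r" by blast
  qed
  then show ?thesis using p_support_mono by (fastforce simp: U_omega_def saturated_ideal_def)
qed


section \<open>Detecting RB-domains\<close>

locale countable_basis_domain =
  fixes X :: "'a::order set" and B :: "'a set"
  assumes X: "is_domain X" and B: "countable B" "is_basis X B"
begin

abbreviation index :: "'a \<Rightarrow> nat" where
  "index \<equiv> to_nat_on B"

definition below_indices :: "'a \<Rightarrow> nat set" where
  "below_indices x = index ` {b \<in> B. way_below X b x}"

definition index_rel :: "nat rel" where
  "index_rel = {(index b, index c) | b c. b \<in> B \<and> c \<in> B \<and> b \<le> c}"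

text \<open>
  The ideals of rooted orders correspond to the directed orders on nonempty subsets of the naturals; this
  is the ideal of the basis elements way below \<open>x\<close>, ordered as in \<open>X\<close>.
\<close>
definition basis_ideal :: "'a \<Rightarrow> p_omega set" where
  "basis_ideal x = {p. p_support p \<subseteq> below_indices x \<and>
     (p = PBot \<or> (\<exists>\<alpha>. p = PRooted \<alpha> \<and> ro_rel \<alpha> \<subseteq> index_rel))}"

lemma continuous_X: "continuous_dcpo X"
  using X by (simp add: is_domain_def)

lemma basis_approximates:
  assumes "x \<in> X"
  shows "directed {b \<in> B. way_below X b x}" and "isLub X {b \<in> B. way_below X b x} x"
  using assms B(2) by (auto simp: is_basis_def)

lemma index_eq_iff: "b \<in> B \<Longrightarrow> c \<in> B \<Longrightarrow> index b = index c \<longleftrightarrow> b = c"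
  using B(1) by simp

lemma index_rel_iff: "b \<in> B \<Longrightarrow> c \<in> B \<Longrightarrow> (index b, index c) \<in> index_rel \<longleftrightarrow> b \<le> c"
  unfolding index_rel_def using index_eq_iff by blast

text \<open>On \<open>B\<close> the indexing is injective, so the order of \<open>X\<close>
  restricted to \<open>A\<close> can be transported to the indices, with \<open>c\<close> becoming
  the root.\<close>

lemma rooted_subset_of_basis:
  assumes "finite A" and "A \<subseteq> B" and "c \<in> A" and "\<forall>a\<in>A. a \<le> c"
  obtains \<alpha> where "ro_carrier \<alpha> = index ` A" and "ro_rel \<alpha> = index_rel \<inter> index ` A \<times> index ` A"
proof (rule rooted_order_exists)
  show "finite (index ` A)" "index c \<in> index ` A" using assms by auto
  show "\<forall>x\<in>index ` A. (x, index c) \<in> index_rel \<inter> index ` A \<times> index ` A"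
    using assms index_rel_iff by blast
  have "trans (index_rel \<inter> index ` A \<times> index ` A)"
  proof (rule transI)
    fix x y z
    assume "(x, y) \<in> index_rel \<inter> index ` A \<times> index ` A" "(y, z) \<in> index_rel \<inter> index ` A \<times> index ` A"
    then obtain a b d where "x = index a" "y = index b" "z = index d" "a \<in> A" "b \<in> A" "d \<in> A"
      "(index a, index b) \<in> index_rel" "(index b, index d) \<in> index_rel" by auto
    moreover then have "a \<le> b" "b \<le> d" using assms(2) index_rel_iff by (blast+)
    ultimately show "(x, z) \<in> index_rel \<inter> index ` A \<times> index ` A"
      using assms(2) index_rel_iff by (auto intro: order_trans)
  qed
  moreover have "antisym (index_rel \<inter> index ` A \<times> index ` A)"
  proof (rule antisymI)
    fix x y
    assume "(x, y) \<in> index_rel \<inter> index ` A \<times> index ` A" "(y, x) \<in> index_rel \<inter> index ` A \<times> index ` A"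
    then obtain a b where "x = index a" "y = index b" "a \<in> A" "b \<in> A"
      "(index a, index b) \<in> index_rel" "(index b, index a) \<in> index_rel" by auto
    moreover then have "a \<le> b" "b \<le> a" using assms(2) index_rel_iff by (blast+)
    ultimately show "x = y" by auto
  qed
  moreover have "refl_on (index ` A) (index_rel \<inter> index ` A \<times> index ` A)"
    using assms(2) index_rel_iff by (auto simp: refl_on_def)
  ultimately show "partial_order_on (index ` A) (index_rel \<inter> index ` A \<times> index ` A)"
    by (auto simp: partial_order_on_def preorder_on_def)
qed

lemma basis_ideal_rooted_bound:
  assumes "x \<in> X" and "finite A" and "A \<subseteq> {b \<in> B. way_below X b x}"
  obtains \<gamma> where "PRooted \<gamma> \<in> basis_ideal x" and "index ` A \<subseteq> ro_carrier \<gamma>"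
    and "index_rel \<inter> index ` A \<times> index ` A \<subseteq> ro_rel \<gamma>"
proof -
  obtain c where c: "c \<in> {b \<in> B. way_below X b x}" "\<forall>a\<in>A. a \<le> c"
    using directed_finite_bound[OF basis_approximates(1)[OF assms(1)] assms(2,3)] by blast
  \<comment> \<open>The bound \<open>c\<close> is adjoined to serve as the root. This also covers
    empty \<open>A\<close>, where it yields a generator different from \<open>PBot\<close>.\<close>
  obtain \<gamma> where \<gamma>: "ro_carrier \<gamma> = index ` insert c A"
    "ro_rel \<gamma> = index_rel \<inter> index ` insert c A \<times> index ` insert c A"
    by (rule rooted_subset_of_basis[of "insert c A" c]) (use assms(2,3) c in auto)
  have "PRooted \<gamma> \<in> basis_ideal x"
    using \<gamma> c(1) assms(3) by (auto simp: basis_ideal_def below_indices_def)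
  then show thesis using that[of \<gamma>] \<gamma> by auto
qed

lemma basis_ideal_in_U_omega:
  assumes x: "x \<in> X"
  shows "basis_ideal x \<in> U_omega"
proof -
  have "directed (basis_ideal x)"
    unfolding directed_def
  proof (intro conjI ballI)
    have "PBot \<in> basis_ideal x" by (simp add: basis_ideal_def)
    then show "basis_ideal x \<noteq> {}" by blast
    fix p q assume pq: "p \<in> basis_ideal x" "q \<in> basis_ideal x"
    have sub: "p_support r \<subseteq> below_indices x" if "r \<in> basis_ideal x" for r
      using that by (auto simp: basis_ideal_def)
    have "finite (p_support p \<union> p_support q)" by (simp add: finite_p_support)
    moreover have "p_support p \<union> p_support q \<subseteq> index ` {b \<in> B. way_below X b x}"
      using sub pq by (auto simp: below_indices_def)
    ultimately obtain A where A: "A \<subseteq> {b \<in> B. way_below X b x}" "finite A"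
      "p_support p \<union> p_support q = index ` A"
      by (meson finite_subset_image)
    obtain \<gamma> where \<gamma>: "PRooted \<gamma> \<in> basis_ideal x" "index ` A \<subseteq> ro_carrier \<gamma>"
      "index_rel \<inter> index ` A \<times> index ` A \<subseteq> ro_rel \<gamma>"
      using basis_ideal_rooted_bound[OF x A(2,1)] by blast
    have "r \<le> PRooted \<gamma>" if r: "r \<in> basis_ideal x" "p_support r \<subseteq> index ` A" for r
    proof (cases r)
      case (PRooted \<alpha>)
      then have "ro_rel \<alpha> \<subseteq> index_rel" "ro_carrier \<alpha> \<subseteq> index ` A" using r by (auto simp: basis_ideal_def)
      then have "ro_carrier \<alpha> \<subseteq> ro_carrier \<gamma>" "ro_rel \<alpha> \<subseteq> ro_rel \<gamma>"
        using \<gamma>(2,3) ro_rel_carrier[of \<alpha>] by blast+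
      then show ?thesis using PRooted by simp
    qed (use r in \<open>auto simp: basis_ideal_def\<close>)
    then show "\<exists>r\<in>basis_ideal x. p \<le> r \<and> q \<le> r" using pq \<gamma>(1) A(3) by blast
  qed
  moreover have "q \<in> basis_ideal x" if "p \<in> basis_ideal x" "q \<le> p" for p q
    using that p_support_mono[OF that(2)] by (cases p; cases q) (auto simp: basis_ideal_def)
  ultimately show ?thesis by (auto simp: U_omega_def)
qed

section \<open>Indices below a point and Scott continuity\<close>

lemma below_indices_mono: "x \<in> X \<Longrightarrow> y \<in> X \<Longrightarrow> x \<le> y \<Longrightarrow> below_indices x \<subseteq> below_indices y"
  using way_below_trans2[of y X _ x] unfolding below_indices_def by (intro image_mono Collect_mono) simp

lemma below_indices_lub:
  assumes D: "D \<subseteq> X" "directed D" "isLub X D s"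
  shows "below_indices s = (\<Union>x\<in>D. below_indices x)"
proof
  show "below_indices s \<subseteq> (\<Union>x\<in>D. below_indices x)"
  proof
    fix n assume "n \<in> below_indices s"
    then obtain b where b: "b \<in> B" "way_below X b s" "n = index b" by (auto simp: below_indices_def)
    obtain d where "d \<in> D" "way_below X b d"
      using way_below_directed_lub[OF continuous_X D b(2)] .
    then show "n \<in> (\<Union>x\<in>D. below_indices x)" using b by (auto simp: below_indices_def)
  qed
  show "(\<Union>x\<in>D. below_indices x) \<subseteq> below_indices s"
    using D by (intro UN_least below_indices_mono) (auto simp: isLub_iff)
qed

lemma below_indices_finite_witness:
  assumes D: "D \<subseteq> X" "directed D" "isLub X D s" and "finite N" and "N \<subseteq> below_indices s"
  shows "\<exists>x\<in>D. N \<subseteq> below_indices x"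
proof -
  have "\<exists>x\<in>D. \<forall>n\<in>N. x \<in> X \<and> n \<in> below_indices x"
  proof (rule directed_finite_witness[OF D(2) assms(4)])
    show "\<exists>x\<in>D. x \<in> X \<and> n \<in> below_indices x" if "n \<in> N" for n
      using that assms(5) D(1) below_indices_lub[OF D] by blast
    show "y \<in> X \<and> n \<in> below_indices y"
      if "x \<in> X \<and> n \<in> below_indices x" "x \<le> y" "y \<in> D" for n x y
      using that D(1) below_indices_mono[of x y] by auto
  qed
  then show ?thesis by auto
qed

text \<open>Whether \<open>p\<close> belongs to \<open>f x\<close> depends on \<open>x\<close> only
  through a finite set of indices, and a finite subset of a directed union is contained in one of
  its members. Both \<open>basis_ideal\<close> and \<open>truncation\<close> have this form.\<close>

lemma support_determined_scott:
  assumes "\<And>x. x \<in> X \<Longrightarrow> f x \<in> U_omega"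
    and "\<And>x p. x \<in> X \<Longrightarrow> p \<in> f x \<longleftrightarrow> p_support p \<subseteq> below_indices x \<and> Q p"
  shows "(\<lambda>x\<in>X. f x) \<in> scott_maps X U_omega"
proof (rule scott_mapsI)
  show "(\<lambda>x\<in>X. f x) x \<subseteq> (\<lambda>x\<in>X. f x) y" if "x \<in> X" "y \<in> X" "x \<le> y" for x y
    using that assms(2) below_indices_mono by fastforce
  fix D s u assume D: "D \<subseteq> X" "directed D" "isLub X D s"
    and u: "\<And>d. d \<in> D \<Longrightarrow> (\<lambda>x\<in>X. f x) d \<subseteq> u"
  have s: "s \<in> X" using D(3) by (simp add: isLub_iff)
  show "(\<lambda>x\<in>X. f x) s \<subseteq> u"
  proof
    fix p assume "p \<in> (\<lambda>x\<in>X. f x) s"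
    then have p: "p_support p \<subseteq> below_indices s" "Q p" using s assms(2) by auto
    then obtain d where "d \<in> D" "p_support p \<subseteq> below_indices d"
      using below_indices_finite_witness[OF D finite_p_support] by blast
    moreover then have "d \<in> X" using D(1) by blast
    ultimately show "p \<in> u" using u[of d] p(2) assms(2)[of d p] by auto
  qed
qed (use assms(1) in auto)

lemma basis_ideal_scott: "(\<lambda>x\<in>X. basis_ideal x) \<in> scott_maps X U_omega"
  by (rule support_determined_scott[OF basis_ideal_in_U_omega]) (auto simp: basis_ideal_def)

lemma basis_ideal_nontrivial:
  assumes "x \<in> X"
  obtains p where "p \<in> basis_ideal x" and "p \<noteq> PBot"
proof -
  obtain \<gamma> where "PRooted \<gamma> \<in> basis_ideal x"
    using basis_ideal_rooted_bound[OF assms, of "{}"] by auto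
  then show thesis using that by blast
qed

section \<open>Truncations to finitely many indices\<close>

definition truncation :: "nat \<Rightarrow> 'a \<Rightarrow> p_omega set" where
  "truncation n = (\<lambda>x\<in>X. saturated_ideal (below_indices x \<inter> {..<n}))"

lemma truncation_scott: "truncation n \<in> scott_maps X U_omega"
  unfolding truncation_def
  by (rule support_determined_scott[where Q = "\<lambda>p. p_support p \<subseteq> {..<n}",
        OF saturated_ideal_in_U_omega]) (auto simp: saturated_ideal_def)

lemma directed_range_truncation: "directed (range truncation)"
proof (rule directed_image)
  show "directed (UNIV :: nat set)" unfolding directed_def by (auto intro: max.cobounded1 max.cobounded2)
  show "truncation m \<le> truncation n" if "m \<le> n" for m n
    using that by (fastforce simp: le_fun_def truncation_def saturated_ideal_def)
qed

lemma isLub_truncation_at: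
  assumes "x \<in> X"
  shows "isLub U_omega ((\<lambda>h. h x) ` range truncation) (saturated_ideal (below_indices x))"
proof -
  have "(\<lambda>h. h x) ` range truncation \<subseteq> U_omega" using truncation_scott scott_mapsD(1) assms by blast
  then have "isLub U_omega ((\<lambda>h. h x) ` range truncation) (\<Union>((\<lambda>h. h x) ` range truncation))"
    using directed_range_truncation by (intro isLub_U_omega_Union scott_maps_directed_at)
  moreover have "\<Union>((\<lambda>h. h x) ` range truncation) = saturated_ideal (below_indices x)"
  proof
    show "\<Union>((\<lambda>h. h x) ` range truncation) \<subseteq> saturated_ideal (below_indices x)"
      using assms by (auto simp: truncation_def saturated_ideal_def)
    show "saturated_ideal (below_indices x) \<subseteq> \<Union>((\<lambda>h. h x) ` range truncation)"
    proof
      fix p assume p: "p \<in> saturated_ideal (below_indices x)"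
      obtain n where "p_support p \<subseteq> {..<n}" using finite_p_support finite_nat_iff_bounded by blast
      then have "p \<in> truncation n x" using p assms by (auto simp: truncation_def saturated_ideal_def)
      then show "p \<in> \<Union>((\<lambda>h. h x) ` range truncation)" by blast
    qed
  qed
  ultimately show ?thesis by simp
qed

lemma basis_ideal_le_saturated: "basis_ideal x \<subseteq> saturated_ideal (below_indices x)"
  by (auto simp: basis_ideal_def saturated_ideal_def)

section \<open>Deflations from the roots of ideals\<close>

definition root_of :: "p_omega set \<Rightarrow> 'a" where
  "root_of I = inv_into B index (ro_top (SOME \<alpha>. PRooted \<alpha> \<in> I \<and> (\<forall>p\<in>I. p \<le> PRooted \<alpha>)))"

text \<open>Inside \<open>basis_ideal x\<close> there are no generators \<open>PU M\<close>, and
  only finitely many rooted orders live on \<open>N\<close>. So \<open>I\<close> is finite and,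
  being directed, has a greatest element, which \<open>p\<close> keeps from being
  \<open>PBot\<close>.\<close>

lemma root_ofE:
  assumes "x \<in> X" and "I \<in> U_omega" and "I \<subseteq> basis_ideal x" and "p \<in> I" and "p \<noteq> PBot"
    and "finite N" and "\<And>q. q \<in> I \<Longrightarrow> p_support q \<subseteq> N"
  obtains \<alpha> where "PRooted \<alpha> \<in> I" and "\<And>q. q \<in> I \<Longrightarrow> q \<le> PRooted \<alpha>"
    and "root_of I = inv_into B index (ro_top \<alpha>)"
proof -
  have "I \<subseteq> insert PBot (PRooted ` {\<alpha>. ro_carrier \<alpha> \<subseteq> N})"
    using assms(3,7) by (fastforce simp: basis_ideal_def)
  then have "finite I" using finite_rooted_orders[OF assms(6)] by (auto intro: finite_subset)
  then obtain m where m: "m \<in> I" "\<And>q. q \<in> I \<Longrightarrow> q \<le> m"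
    using finite_directed_max[OF U_omegaD(1)[OF assms(2)]] by blast
  have "m \<noteq> PBot" using m(2)[OF assms(4)] assms(5) by (cases p) auto
  then obtain \<alpha> where "m = PRooted \<alpha>" using m(1) assms(3) by (force simp: basis_ideal_def)
  then have ex: "\<exists>\<alpha>. PRooted \<alpha> \<in> I \<and> (\<forall>p\<in>I. p \<le> PRooted \<alpha>)" using m by blast
  \<comment> \<open>This repeats the choice made in \<open>root_of\<close>. Greatest elements are
    unique, so there is only one candidate.\<close>
  define \<beta> where "\<beta> = (SOME \<alpha>. PRooted \<alpha> \<in> I \<and> (\<forall>p\<in>I. p \<le> PRooted \<alpha>))"
  have \<beta>: "PRooted \<beta> \<in> I \<and> (\<forall>p\<in>I. p \<le> PRooted \<beta>)"
    unfolding \<beta>_def using ex by (rule someI_ex)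
  show thesis
  proof (rule that)
    show "PRooted \<beta> \<in> I" using \<beta> ..
    show "q \<le> PRooted \<beta>" if "q \<in> I" for q using \<beta> that by simp
    show "root_of I = inv_into B index (ro_top \<beta>)" by (simp add: root_of_def \<beta>_def)
  qed
qed

lemma basis_ideal_top:
  assumes "PRooted \<alpha> \<in> basis_ideal x"
  obtains b where "b \<in> B" and "way_below X b x" and "ro_top \<alpha> = index b"
    and "inv_into B index (ro_top \<alpha>) = b"
proof -
  have "ro_top \<alpha> \<in> below_indices x"
    using assms rooted_order_props(4)[of \<alpha>] by (auto simp: basis_ideal_def)
  then obtain b where "b \<in> B" "way_below X b x" "ro_top \<alpha> = index b"
    by (auto simp: below_indices_def)
  moreover then have "inv_into B index (index b) = b" using B(1) by (intro inv_into_f_f inj_on_to_nat_on)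
  ultimately show thesis using that by simp
qed

text \<open>The root of \<alpha> belongs to the carrier of \<beta>, hence lies below the root of
  \<beta> in its relation. That relation is part of \<open>index_rel\<close>, which reflects the
  order of \<open>X\<close>.\<close>

lemma basis_ideal_top_mono:
  assumes "PRooted \<alpha> \<le> PRooted \<beta>" and "PRooted \<beta> \<in> basis_ideal y"
  shows "inv_into B index (ro_top \<alpha>) \<le> inv_into B index (ro_top \<beta>)"
proof -
  have "PRooted \<alpha> \<in> basis_ideal y"
    using assms by (auto simp: basis_ideal_def)
  then obtain a where a: "a \<in> B" "ro_top \<alpha> = index a" "inv_into B index (ro_top \<alpha>) = a"
    by (rule basis_ideal_top)
  obtain b where b: "b \<in> B" "ro_top \<beta> = index b" "inv_into B index (ro_top \<beta>) = b"
    using assms(2) by (rule basis_ideal_top)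
  have "ro_top \<alpha> \<in> ro_carrier \<beta>" using assms(1) rooted_order_props(4)[of \<alpha>] by auto
  then have "(ro_top \<alpha>, ro_top \<beta>) \<in> ro_rel \<beta>" using rooted_order_props(5)[of \<beta>] by blast
  then have "(index a, index b) \<in> index_rel" using assms(2) a b by (auto simp: basis_ideal_def)
  then show ?thesis using a b index_rel_iff by simp
qed

lemma root_of_mono:
  assumes I: "x \<in> X" "I \<in> U_omega" "I \<subseteq> basis_ideal x" "p \<in> I" "p \<noteq> PBot"
      "finite N" "\<And>q. q \<in> I \<Longrightarrow> p_support q \<subseteq> N"
    and J: "y \<in> X" "J \<in> U_omega" "J \<subseteq> basis_ideal y" "finite M" "\<And>q. q \<in> J \<Longrightarrow> p_support q \<subseteq> M"
    and "I \<subseteq> J"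
  shows "root_of I \<le> root_of J"
proof -
  obtain \<alpha> where \<alpha>: "PRooted \<alpha> \<in> I" "root_of I = inv_into B index (ro_top \<alpha>)"
    using I by (rule root_ofE)
  have "p \<in> J" using I(4) \<open>I \<subseteq> J\<close> by blast
  obtain \<beta> where \<beta>: "PRooted \<beta> \<in> J" "\<And>q. q \<in> J \<Longrightarrow> q \<le> PRooted \<beta>"
      "root_of J = inv_into B index (ro_top \<beta>)"
    using root_ofE[OF J(1-3) \<open>p \<in> J\<close> I(5) J(4,5)] by blast
  have "PRooted \<alpha> \<le> PRooted \<beta>" using \<beta>(2) \<alpha>(1) \<open>I \<subseteq> J\<close> by blast
  then show ?thesis using basis_ideal_top_mono[of \<alpha> \<beta> y] \<beta>(1,3) J(3) \<alpha>(2) by auto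
qed

text \<open>Inclusion in \<open>basis_ideal x\<close> puts the root below \<open>x\<close>, and the
  truncation bound leaves only finitely many possible roots. Scott continuity holds because each
  \<open>g s\<close> has a greatest generator.\<close>

lemma deflation_root_of:
  assumes g: "g \<in> scott_maps X U_omega" and le: "\<And>x. x \<in> X \<Longrightarrow> g x \<subseteq> basis_ideal x"
    and bounded: "g \<le> truncation n" and nt: "\<And>x. x \<in> X \<Longrightarrow> \<exists>p\<in>g x. p \<noteq> PBot"
  shows "deflation X (\<lambda>x\<in>X. root_of (g x))"
proof -
  have U: "g x \<in> U_omega" if "x \<in> X" for x using g that by (rule scott_mapsD(1))
  have supp: "p_support q \<subseteq> {..<n}" if "x \<in> X" "q \<in> g x" for x q
    using le_funD[OF bounded, of x] that by (auto simp: truncation_def saturated_ideal_def)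
  have root: "\<exists>\<alpha>. PRooted \<alpha> \<in> g x \<and> (\<forall>q\<in>g x. q \<le> PRooted \<alpha>) \<and> root_of (g x) = inv_into B index (ro_top \<alpha>)"
    if x: "x \<in> X" for x
  proof -
    obtain p where "p \<in> g x" "p \<noteq> PBot" using nt[OF x] by blast
    then obtain \<alpha> where "PRooted \<alpha> \<in> g x" "\<And>q. q \<in> g x \<Longrightarrow> q \<le> PRooted \<alpha>"
      "root_of (g x) = inv_into B index (ro_top \<alpha>)"
      using root_ofE[OF x U[OF x] le[OF x] _ _ finite_lessThan[of n] supp[OF x]] by blast
    then show ?thesis by blast
  qed
  have mono: "root_of (g x) \<le> root_of (g y)" if xy: "x \<in> X" "y \<in> X" "g x \<subseteq> g y" for x y
  proof -
    obtain p where p: "p \<in> g x" "p \<noteq> PBot" using nt[OF xy(1)] by blast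
    show ?thesis
      by (rule root_of_mono[OF xy(1) U[OF xy(1)] le[OF xy(1)] p finite_lessThan[of n] supp[OF xy(1)]
            xy(2) U[OF xy(2)] le[OF xy(2)] finite_lessThan[of n] supp[OF xy(2)] xy(3)])
  qed
  have below: "way_below X (root_of (g x)) x" "root_of (g x) \<in> inv_into B index ` {..<n}" if x: "x \<in> X" for x
  proof -
    obtain \<alpha> where \<alpha>: "PRooted \<alpha> \<in> g x" "root_of (g x) = inv_into B index (ro_top \<alpha>)"
      using root[OF x] by blast
    then show "way_below X (root_of (g x)) x" using basis_ideal_top[of \<alpha> x] le[OF x] by (metis subsetD)
    have "ro_top \<alpha> < n" using supp[OF x \<alpha>(1)] rooted_order_props(4)[of \<alpha>] by auto
    then show "root_of (g x) \<in> inv_into B index ` {..<n}" using \<alpha>(2) by auto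
  qed
  have "(\<lambda>x\<in>X. root_of (g x)) \<in> scott_maps X X"
  proof (rule scott_mapsI)
    show "(\<lambda>x\<in>X. root_of (g x)) x \<in> X" if "x \<in> X" for x
      using below(1)[OF that] that by (simp add: way_below_carrier)
    show "(\<lambda>x\<in>X. root_of (g x)) x \<le> (\<lambda>x\<in>X. root_of (g x)) y" if "x \<in> X" "y \<in> X" "x \<le> y" for x y
      using mono[OF that(1,2)] scott_mapsD(3)[OF g that] that by simp
    fix D s u assume D: "D \<subseteq> X" "directed D" "isLub X D s"
      and u: "\<And>d. d \<in> D \<Longrightarrow> (\<lambda>x\<in>X. root_of (g x)) d \<le> u"
    have s: "s \<in> X" using D(3) by (simp add: isLub_iff)
    have "g ` D \<subseteq> U_omega" using U D(1) by auto
    then have gs: "g s = \<Union>(g ` D)"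
      using isLub_U_omegaD scott_maps_image_directed[OF g D(1,2)] scott_mapsD(4)[OF g D] by blast
    obtain \<alpha> where \<alpha>: "PRooted \<alpha> \<in> g s" "\<forall>q\<in>g s. q \<le> PRooted \<alpha>" using root[OF s] by blast
    then obtain d where d: "d \<in> D" "PRooted \<alpha> \<in> g d" using gs by auto
    have dX: "d \<in> X" using d(1) D(1) by blast
    \<comment> \<open>The greatest generator of \<open>g s\<close> has already appeared in
      \<open>g d\<close>, so the supremum of the roots over \<open>D\<close> is attained at
      \<open>d\<close>.\<close>
    have "g s \<subseteq> g d" using \<alpha>(2) U_omegaD(2)[OF U[OF dX] d(2)] by blast
    then have "root_of (g s) \<le> root_of (g d)" using mono s dX by blast
    also have "\<dots> \<le> u" using u[OF d(1)] dX by simp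
    finally show "(\<lambda>x\<in>X. root_of (g x)) s \<le> u" using s by simp
  qed simp
  moreover have "finite ((\<lambda>x\<in>X. root_of (g x)) ` X)"
    by (rule finite_subset[of _ "inv_into B index ` {..<n}"]) (use below(2) in auto)
  ultimately show ?thesis using below(1) by (auto simp: deflation_def dest: way_below_le)
qed

lemma rb_domain_approximations:
  assumes G: "G \<subseteq> scott_maps X U_omega" "directed G"
    and Union: "\<And>x. x \<in> X \<Longrightarrow> (\<Union>g\<in>G. g x) = basis_ideal x"
    and bounded: "\<And>g. g \<in> G \<Longrightarrow> \<exists>n. g \<le> truncation n"
    and g0: "g0 \<in> G" "\<And>x. x \<in> X \<Longrightarrow> \<exists>p\<in>g0 x. p \<noteq> PBot"
  shows "rb_domain X"
proof -
  \<comment> \<open>Above \<open>g0\<close> every value contains a generator other than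
    \<open>PBot\<close>, so \<open>root_of\<close> is meaningful; directedness makes this part of
    \<open>G\<close> cofinal.\<close>
  define H where "H = {g \<in> G. g0 \<le> g}"
  define \<delta> where "\<delta> g = (\<lambda>x\<in>X. root_of (g x))" for g
  have H: "directed H" "H \<subseteq> G" using directed_above[OF G(2) g0(1)] by (auto simp: H_def)
  have U: "g x \<in> U_omega" if "g \<in> H" "x \<in> X" for g x using that H(2) G(1) scott_mapsD(1) by blast
  have le: "g x \<subseteq> basis_ideal x" if "g \<in> H" "x \<in> X" for g x using Union[OF that(2)] that(1) H(2) by blast
  have nt: "\<exists>p\<in>g x. p \<noteq> PBot" if "g \<in> H" "x \<in> X" for g x
    using g0(2)[OF that(2)] le_funD[of g0 g x] that(1) by (auto simp: H_def)
  have supp: "\<exists>n. \<forall>x\<in>X. \<forall>q\<in>g x. p_support q \<subseteq> {..<n}" if g: "g \<in> H" for g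
  proof -
    obtain n where n: "g \<le> truncation n" using bounded g H(2) by blast
    then have "p_support q \<subseteq> {..<n}" if "x \<in> X" "q \<in> g x" for x q
      using le_funD[OF n, of x] that by (auto simp: truncation_def saturated_ideal_def)
    then show ?thesis by blast
  qed
  have defl: "deflation X (\<delta> g)" if g: "g \<in> H" for g
  proof -
    obtain n where "g \<le> truncation n" using bounded g H(2) by blast
    then show ?thesis
      unfolding \<delta>_def using g G(1) H(2) le nt by (intro deflation_root_of) auto
  qed
  have mono: "\<delta> g \<le> \<delta> h" if gh: "g \<in> H" "h \<in> H" "g \<le> h" for g h
  proof (rule le_funI)
    fix x
    show "\<delta> g x \<le> \<delta> h x"
    proof (cases "x \<in> X")
      case True
      obtain p where p: "p \<in> g x" "p \<noteq> PBot" using nt[OF gh(1) True] by blast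
      obtain m n where mn: "\<And>q. q \<in> g x \<Longrightarrow> p_support q \<subseteq> {..<m}" "\<And>q. q \<in> h x \<Longrightarrow> p_support q \<subseteq> {..<n}"
        using supp[OF gh(1)] supp[OF gh(2)] True by meson
      have "root_of (g x) \<le> root_of (h x)"
        by (rule root_of_mono[OF True U[OF gh(1) True] le[OF gh(1) True] p finite_lessThan[of m] mn(1)
              True U[OF gh(2) True] le[OF gh(2) True] finite_lessThan[of n] mn(2) le_funD[OF gh(3)]])
      then show ?thesis using True by (simp add: \<delta>_def)
    qed (simp add: \<delta>_def)
  qed
  have "isLub (scott_maps X X) (\<delta> ` H) (\<lambda>x\<in>X. x)"
  proof (rule scott_maps_isLubI)
    show "\<delta> ` H \<subseteq> scott_maps X X" using defl by (auto simp: deflation_def)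
    fix x assume x: "x \<in> X"
    have "b \<le> u" if b: "b \<in> {b \<in> B. way_below X b x}" and u: "\<And>g. g \<in> H \<Longrightarrow> \<delta> g x \<le> u" for b u
    proof -
      \<comment> \<open>The one-point rooted order at \<open>b\<close>. Once it lies in
        \<open>h x\<close>, it is below the greatest generator there, so the root of
        \<open>h x\<close> is above \<open>b\<close>.\<close>
      obtain \<sigma> where \<sigma>: "ro_carrier \<sigma> = index ` {b}" "ro_rel \<sigma> = index_rel \<inter> index ` {b} \<times> index ` {b}"
        by (rule rooted_subset_of_basis[of "{b}" b]) (use b in auto)
      then have s: "PRooted \<sigma> \<in> basis_ideal x" using b by (auto simp: basis_ideal_def below_indices_def)
      then obtain g where g: "g \<in> G" "PRooted \<sigma> \<in> g x" using Union[OF x] by blast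
      obtain h where "h \<in> G" "g0 \<le> h" "g \<le> h" using G(2) g0(1) g(1) unfolding directed_def by blast
      then have h: "h \<in> H" "PRooted \<sigma> \<in> h x" using g(2) by (auto simp: H_def le_fun_def)
      obtain n where n: "\<And>q. q \<in> h x \<Longrightarrow> p_support q \<subseteq> {..<n}" using supp[OF h(1)] x by blast
      obtain \<alpha> where \<alpha>: "PRooted \<alpha> \<in> h x" "\<And>q. q \<in> h x \<Longrightarrow> q \<le> PRooted \<alpha>"
        "root_of (h x) = inv_into B index (ro_top \<alpha>)"
        using root_ofE[OF x U[OF h(1) x] le[OF h(1) x] h(2) _ finite_lessThan[of n] n] by blast
      have "ro_top \<sigma> = index b" using rooted_order_props(4)[of \<sigma>] \<sigma>(1) by auto
      moreover have "inv_into B index (index b) = b"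
        using b B(1) by (intro inv_into_f_f inj_on_to_nat_on) auto
      ultimately have "b \<le> root_of (h x)"
        using basis_ideal_top_mono[OF \<alpha>(2)[OF h(2)]] \<alpha>(1,3) le[OF h(1) x] by auto
      also have "\<dots> \<le> u" using u[OF h(1)] x by (simp add: \<delta>_def)
      finally show ?thesis .
    qed
    then have "x \<le> u" if "u \<in> X" "\<And>g. g \<in> H \<Longrightarrow> \<delta> g x \<le> u" for u
      using basis_approximates(2)[OF x] that unfolding isLub_iff by blast
    then show "isLub X ((\<lambda>g. g x) ` \<delta> ` H) ((\<lambda>x\<in>X. x) x)"
      using x defl by (auto simp: isLub_iff deflation_def)
  qed simp
  moreover have "directed (\<delta> ` H)" using H(1) mono by (rule directed_image)
  ultimately show ?thesis
    unfolding rb_domain_def using X defl by (intro conjI exI[of _ "\<delta> ` H"]) auto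
qed

lemma rb_domain_if_continuous_U_omega:
  assumes cont: "continuous_dcpo (scott_maps X U_omega)" and "pointed X"
  shows "rb_domain X"
proof -
  let ?f = "\<lambda>x\<in>X. basis_ideal x"
  define G where "G = {g \<in> scott_maps X U_omega. way_below (scott_maps X U_omega) g ?f}"
  have G: "G \<subseteq> scott_maps X U_omega" "directed G" "isLub (scott_maps X U_omega) G ?f"
    using continuous_dcpoD[OF cont basis_ideal_scott] by (auto simp: G_def)
  have Union: "(\<Union>g\<in>G. g x) = basis_ideal x" if x: "x \<in> X" for x
  proof -
    have "isLub U_omega ((\<lambda>g. g x) ` G) (?f x)"
      using dcpo_U_omega G x by (rule scott_maps_isLub_at)
    moreover have "(\<lambda>g. g x) ` G \<subseteq> U_omega" using G(1) x scott_mapsD(1) by blast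
    ultimately have "?f x = \<Union>((\<lambda>g. g x) ` G)"
      using isLub_U_omegaD scott_maps_directed_at[OF G(2)] by blast
    then show ?thesis using x by simp
  qed
  have sat: "isLub (scott_maps X U_omega) (range truncation) (\<lambda>x\<in>X. saturated_ideal (below_indices x))"
    by (rule scott_maps_isLubI) (use truncation_scott isLub_truncation_at in auto)
  have bounded: "\<exists>n. g \<le> truncation n" if "g \<in> G" for g
  proof -
    have "range truncation \<subseteq> scott_maps X U_omega" using truncation_scott by blast
    moreover have "?f \<le> (\<lambda>x\<in>X. saturated_ideal (below_indices x))"
      using basis_ideal_le_saturated by (simp add: le_fun_def)
    ultimately show ?thesis
      using way_belowD[of "scott_maps X U_omega" g ?f, OF _ _ directed_range_truncation sat] that
      unfolding G_def by blast
  qed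
  obtain a where a: "a \<in> X" "\<And>x. x \<in> X \<Longrightarrow> a \<le> x" using \<open>pointed X\<close> by (auto simp: pointed_def)
  obtain p where "p \<in> basis_ideal a" "p \<noteq> PBot" using basis_ideal_nontrivial[OF a(1)] .
  then obtain g where g: "g \<in> G" "p \<in> g a" using Union[OF a(1)] by blast
  \<comment> \<open>A generator in the value at the least element is in every value by monotonicity;
    pointedness thus replaces a compactness argument.\<close>
  have "p \<in> g x" if "x \<in> X" for x
    using scott_mapsD(3)[of g X U_omega, OF _ a(1) that a(2)[OF that]] g G(1) by auto
  then have nt: "\<exists>p\<in>g x. p \<noteq> PBot" if "x \<in> X" for x using that \<open>p \<noteq> PBot\<close> by blast
  show ?thesis by (rule rb_domain_approximations[OF G(1,2) Union bounded g(1) nt])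
qed

section \<open>Maps into \<open>A_omega\<close> and compactness\<close>

lemma scott_maps_Pair:
  assumes "f \<in> scott_maps X U_omega" and "k \<in> scott_maps X UNIV"
  shows "(\<lambda>x\<in>X. (f x, k x)) \<in> scott_maps X A_omega"
proof (rule scott_mapsI)
  show "(\<lambda>x\<in>X. (f x, k x)) x \<in> A_omega" if "x \<in> X" for x
    using that scott_mapsD(1)[OF assms(1)] by (simp add: A_omega_def)
  show "(\<lambda>x\<in>X. (f x, k x)) x \<le> (\<lambda>x\<in>X. (f x, k x)) y" if "x \<in> X" "y \<in> X" "x \<le> y" for x y
    using that scott_mapsD(3)[OF assms(1) that] scott_mapsD(3)[OF assms(2) that] by simp
  fix D s u assume D: "D \<subseteq> X" "directed D" "isLub X D s" and u: "u \<in> A_omega"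
    and ub: "\<And>d. d \<in> D \<Longrightarrow> (\<lambda>x\<in>X. (f x, k x)) d \<le> u"
  have ub': "f d \<le> fst u" "k d \<le> snd u" if "d \<in> D" for d
    using ub[OF that] subsetD[OF D(1) that] by (simp_all add: less_eq_prod_def)
  have "\<forall>I\<in>f ` D. I \<le> fst u" "\<forall>i\<in>k ` D. i \<le> snd u" using ub' by blast+
  moreover have "fst u \<in> U_omega" using u by (auto simp: A_omega_def)
  ultimately have "f s \<le> fst u" "k s \<le> snd u"
    using scott_mapsD(4)[OF assms(1) D] scott_mapsD(4)[OF assms(2) D]
    by (simp_all add: isLub_iff)
  moreover have "s \<in> X" using D(3) by (simp add: isLub_iff)
  ultimately show "(\<lambda>x\<in>X. (f x, k x)) s \<le> u" by (simp add: less_eq_prod_def)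
qed simp

lemma scott_maps_fst:
  assumes "g \<in> scott_maps X A_omega"
  shows "(\<lambda>x\<in>X. fst (g x)) \<in> scott_maps X U_omega"
proof (rule scott_mapsI)
  show "(\<lambda>x\<in>X. fst (g x)) x \<in> U_omega" if "x \<in> X" for x
    using scott_mapsD(1)[OF assms that] that by (auto simp: A_omega_def)
  show "(\<lambda>x\<in>X. fst (g x)) x \<le> (\<lambda>x\<in>X. fst (g x)) y" if "x \<in> X" "y \<in> X" "x \<le> y" for x y
    using scott_mapsD(3)[OF assms that] that by (simp add: less_eq_prod_def)
  fix D s u assume D: "D \<subseteq> X" "directed D" "isLub X D s" and u: "u \<in> U_omega"
    and ub: "\<And>d. d \<in> D \<Longrightarrow> (\<lambda>x\<in>X. fst (g x)) d \<le> u"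
  have "isLub U_omega (fst ` g ` D) (fst (g s))"
    using scott_mapsD(4)[OF assms D] by (simp add: A_omega_def isLub_Times)
  moreover have "\<forall>I\<in>fst ` g ` D. I \<le> u" using ub D(1) by (auto simp: subset_iff)
  moreover have "s \<in> X" using D(3) by (simp add: isLub_iff)
  ultimately show "(\<lambda>x\<in>X. fst (g x)) s \<le> u" using u by (simp add: isLub_iff)
qed simp

lemma scott_maps_const:
  assumes "c \<in> Y"
  shows "(\<lambda>x\<in>X. c) \<in> scott_maps X Y"
proof (rule scott_mapsI)
  fix D s u assume D: "D \<subseteq> X" "directed D" "isLub X D s" and ub: "\<And>d. d \<in> D \<Longrightarrow> (\<lambda>x\<in>X. c) d \<le> u"
  obtain d where "d \<in> D" using D(2) by (auto simp: directed_def)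
  then show "(\<lambda>x\<in>X. c) s \<le> u" using ub[of d] D by (auto simp: isLub_iff)
qed (use assms in auto)

text \<open>The hypotheses say that \<open>W\<close> is Scott-open relative to \<open>X\<close>: it
  is an upper set and cannot be entered only in the limit. For \<open>s\<close> outside
  \<open>W\<close>, any member of \<open>D\<close> already has a value above
  \<open>c\<close>.\<close>

lemma scott_maps_top_on_open:
  assumes upper: "\<And>x y. x \<in> W \<Longrightarrow> y \<in> X \<Longrightarrow> x \<le> y \<Longrightarrow> y \<in> W"
    and inacc: "\<And>D s. D \<subseteq> X \<Longrightarrow> directed D \<Longrightarrow> isLub X D s \<Longrightarrow> s \<in> W \<Longrightarrow> \<exists>d\<in>D. d \<in> W"
  shows "(\<lambda>x\<in>X. if x \<in> W then VTop else c) \<in> scott_maps X UNIV"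
proof (rule scott_mapsI)
  show "(\<lambda>x\<in>X. if x \<in> W then VTop else c) x \<le> (\<lambda>x\<in>X. if x \<in> W then VTop else c) y"
    if "x \<in> X" "y \<in> X" "x \<le> y" for x y
    using that upper[of x y] by (simp add: less_eq_v_def)
  fix D s u assume D: "D \<subseteq> X" "directed D" "isLub X D s"
    and ub: "\<And>d. d \<in> D \<Longrightarrow> (\<lambda>x\<in>X. if x \<in> W then VTop else c) d \<le> u"
  have s: "s \<in> X" using D(3) by (simp add: isLub_iff)
  obtain d where d: "d \<in> D" "s \<in> W \<Longrightarrow> d \<in> W"
    using inacc[OF D] D(2) by (auto simp: directed_def)
  have "d \<in> X" using d(1) D(1) by blast
  then show "(\<lambda>x\<in>X. if x \<in> W then VTop else c) s \<le> u"
    using ub[OF d(1)] d(2) s by (auto simp: less_eq_v_def split: if_splits)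
qed auto

text \<open>
  If \<open>c \<noteq> VTop\<close> and \<open>g\<close> is way below the map with constant second component \<open>VTop\<close>, then the second
  component of \<open>g\<close> is \<open>c\<close> off some member of any directed open cover of \<open>X\<close>. Since \<open>VL\<close> and \<open>VR\<close>
  cannot both be that value, one member covers \<open>X\<close>: the factor \<open>v\<close> forces \<open>X\<close> to be compact.
\<close>
lemma rb_domain_if_continuous_A_omega:
  assumes cont: "continuous_dcpo (scott_maps X A_omega)"
  shows "rb_domain X"
proof -
  let ?F = "\<lambda>x\<in>X. (basis_ideal x, VTop)"
  have F: "?F \<in> scott_maps X A_omega"
    using scott_maps_Pair[OF basis_ideal_scott scott_maps_const[of VTop UNIV]]
    by (simp add: restrict_def cong: if_cong)
  define K where "K = {g \<in> scott_maps X A_omega. way_below (scott_maps X A_omega) g ?F}"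
  have K: "K \<subseteq> scott_maps X A_omega" "directed K" "isLub (scott_maps X A_omega) K ?F"
    using continuous_dcpoD[OF cont F] by (auto simp: K_def)
  have way: "way_below (scott_maps X A_omega) g ?F" if "g \<in> K" for g using that by (simp add: K_def)
  define \<pi> where "\<pi> g = (\<lambda>x\<in>X. fst (g x))" for g :: "'a \<Rightarrow> p_omega set \<times> v"
  have \<pi>_mono: "\<pi> g \<le> \<pi> h" if "g \<le> h" for g h
    using that by (auto simp: \<pi>_def le_fun_def less_eq_prod_def)
  have G: "\<pi> ` K \<subseteq> scott_maps X U_omega" "directed (\<pi> ` K)"
    using scott_maps_fst K(1,2) \<pi>_mono by (auto simp: \<pi>_def intro!: directed_image)
  have lubK: "isLub U_omega ((\<lambda>g. fst (g x)) ` K) (basis_ideal x)" if x: "x \<in> X" for x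
    using scott_maps_isLub_at[OF _ K x] is_domain_A_omega x
    by (simp add: A_omega_def isLub_Times image_image is_domain_def continuous_dcpo_def)
  have Union: "(\<Union>g\<in>\<pi> ` K. g x) = basis_ideal x" if x: "x \<in> X" for x
  proof -
    have "(\<lambda>g. fst (g x)) ` K = (\<lambda>g. g x) ` \<pi> ` K" using x by (auto simp: \<pi>_def image_image)
    moreover have "(\<lambda>g. g x) ` \<pi> ` K \<subseteq> U_omega" using G(1) x scott_mapsD(1) by blast
    ultimately have "basis_ideal x = \<Union>((\<lambda>g. g x) ` \<pi> ` K)"
      using isLub_U_omegaD scott_maps_directed_at[OF G(2)] lubK[OF x] by metis
    then show ?thesis by simp
  qed
  have bounded: "\<exists>n. g \<le> truncation n" if g: "g \<in> \<pi> ` K" for g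
  proof -
    \<comment> \<open>With \<open>VTop\<close> attached, the truncations have a supremum above
      \<open>?F\<close>. Some \<open>h n\<close> then bounds the chosen member of \<open>K\<close>,
      and the bound is read off its first component.\<close>
    define h where "h n = (\<lambda>x\<in>X. (truncation n x, VTop))" for n
    have hA: "h n \<in> scott_maps X A_omega" for n
      using scott_maps_Pair[OF truncation_scott scott_maps_const[of VTop UNIV]]
      by (simp add: h_def restrict_def cong: if_cong)
    have dirh: "directed (range h)"
    proof -
      have "range h = (\<lambda>t. \<lambda>x\<in>X. (t x, VTop)) ` range truncation" by (auto simp: h_def)
      moreover have "directed \<dots>"
        using directed_range_truncation by (rule directed_image) (auto simp: le_fun_def)
      ultimately show ?thesis by simp
    qed
    have "isLub (scott_maps X A_omega) (range h) (\<lambda>x\<in>X. (saturated_ideal (below_indices x), VTop))"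
    proof (rule scott_maps_isLubI)
      fix x assume x: "x \<in> X"
      have "(\<lambda>g. fst (g x)) ` range h = (\<lambda>t. t x) ` range truncation"
        "(\<lambda>g. snd (g x)) ` range h = {VTop}"
        using x by (auto simp: h_def image_image)
      then show "isLub A_omega ((\<lambda>g. g x) ` range h)
          ((\<lambda>x\<in>X. (saturated_ideal (below_indices x), VTop)) x)"
        using isLub_truncation_at[OF x] x
        by (simp add: A_omega_def isLub_Times image_image isLub_iff[of UNIV])
    qed (use hA in auto)
    moreover have "?F \<le> (\<lambda>x\<in>X. (saturated_ideal (below_indices x), VTop))"
      using basis_ideal_le_saturated by (simp add: le_fun_def)
    moreover obtain k where k: "k \<in> K" "g = \<pi> k" using g by auto
    moreover have "range h \<subseteq> scott_maps X A_omega" using hA by blast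
    ultimately obtain n where "k \<le> h n"
      using way_belowD[OF way[OF k(1)] _ dirh] by blast
    then have "\<pi> k \<le> \<pi> (h n)" by (rule \<pi>_mono)
    also have "\<pi> (h n) = truncation n"
      by (rule ext) (simp add: \<pi>_def h_def truncation_def)
    finally show ?thesis using k(2) by blast
  qed
  \<comment> \<open>Off \<open>W g\<close> the first component is the bottom ideal. These sets form
    a directed open cover of \<open>X\<close> as \<open>g\<close> ranges over \<open>K\<close>, and
    a member equal to \<open>X\<close> is sought.\<close>
  define W where "W g = {x \<in> X. \<exists>p\<in>fst (g x). p \<noteq> PBot}" for g :: "'a \<Rightarrow> p_omega set \<times> v"
  have W_mono: "W g \<subseteq> W h" if "g \<le> h" for g h
    using that by (fastforce simp: W_def le_fun_def less_eq_prod_def)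
  have W_cover: "\<exists>g\<in>K. x \<in> W g" if x: "x \<in> X" for x
  proof -
    obtain p where "p \<in> basis_ideal x" "p \<noteq> PBot" using basis_ideal_nontrivial[OF x] .
    moreover then obtain g where "g \<in> K" "p \<in> \<pi> g x" using Union[OF x] by blast
    ultimately show ?thesis using x by (auto simp: W_def \<pi>_def)
  qed
  have escape: "\<exists>h\<in>K. \<forall>x\<in>X. x \<notin> W h \<longrightarrow> snd (g x) = c" if g: "g \<in> K" and c: "c \<noteq> VTop" for g c
  proof -
    \<comment> \<open>Lowering the second component to \<open>c\<close> off \<open>W h\<close> still
      gives a family with supremum \<open>?F\<close>, since the sets \<open>W h\<close> cover
      \<open>X\<close>. Hence \<open>g\<close> lies below some \<open>k h\<close>, and below
      \<open>c\<close> there is nothing but \<open>c\<close>.\<close>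
    define k where "k h = (\<lambda>x\<in>X. (basis_ideal x, if x \<in> W h then VTop else c))" for h
    have kA: "k h \<in> scott_maps X A_omega" if h: "h \<in> K" for h
    proof -
      have h': "\<pi> h \<in> scott_maps X U_omega" using G(1) h by blast
      have "(\<lambda>x\<in>X. if x \<in> W h then VTop else c) \<in> scott_maps X UNIV"
      proof (rule scott_maps_top_on_open)
        show "y \<in> W h" if "x \<in> W h" "y \<in> X" "x \<le> y" for x y
          using that scott_mapsD(3)[OF h', of x y] by (auto simp: W_def \<pi>_def)
        fix D s assume D: "D \<subseteq> X" "directed D" "isLub X D s" and s: "s \<in> W h"
        have "\<pi> h ` D \<subseteq> U_omega" using scott_mapsD(1)[OF h'] D(1) by blast
        then have "\<pi> h s = \<Union>(\<pi> h ` D)"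
          using isLub_U_omegaD scott_maps_image_directed[OF h' D(1,2)] scott_mapsD(4)[OF h' D] by blast
        moreover obtain p where "p \<in> \<pi> h s" "p \<noteq> PBot" using s by (auto simp: W_def \<pi>_def)
        ultimately obtain d where "d \<in> D" "p \<in> \<pi> h d" by auto
        moreover from \<open>d \<in> D\<close> have "d \<in> X" using D(1) by blast
        ultimately have "d \<in> W h" using \<open>p \<noteq> PBot\<close> unfolding W_def \<pi>_def restrict_def by auto
        then show "\<exists>d\<in>D. d \<in> W h" using \<open>d \<in> D\<close> by (rule bexI)
      qed
      from scott_maps_Pair[OF basis_ideal_scott this] show ?thesis
        by (simp add: k_def restrict_def cong: if_cong)
    qed
    have kK: "k ` K \<subseteq> scott_maps X A_omega" using kA by blast
    have dirk: "directed (k ` K)"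
    proof (rule directed_image[OF K(2)])
      show "k h \<le> k h'" if "h \<le> h'" for h h'
        using W_mono[OF that] by (auto simp: k_def le_fun_def less_eq_v_def)
    qed
    have "isLub (scott_maps X A_omega) (k ` K) ?F"
    proof (rule scott_maps_isLubI[OF kK])
      fix x assume x: "x \<in> X"
      \<comment> \<open>At each point the supremum is attained: \<open>k h\<close> agrees with
        \<open>?F\<close> at \<open>x\<close> as soon as \<open>x\<close> lies in
        \<open>W h\<close>.\<close>
      obtain h where "h \<in> K" "x \<in> W h" using W_cover[OF x] by blast
      then have "?F x \<in> (\<lambda>g. g x) ` k ` K" using x by (auto simp: k_def image_image intro!: image_eqI[of _ _ h])
      moreover have "\<forall>a\<in>(\<lambda>g. g x) ` k ` K. a \<le> ?F x" using x by (auto simp: k_def less_eq_v_def)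
      moreover have "?F x \<in> A_omega" using scott_mapsD(1)[OF F x] .
      ultimately show "isLub A_omega ((\<lambda>g. g x) ` k ` K) (?F x)" unfolding isLub_iff by blast
    qed simp
    then obtain h where h: "h \<in> K" "g \<le> k h" using way_belowD[OF way[OF g] kK dirk _ order_refl] by blast
    have "snd (g x) = c" if "x \<in> X" "x \<notin> W h" for x
    proof -
      have "snd (g x) \<le> c" using le_funD[OF h(2), of x] that by (simp add: k_def less_eq_prod_def)
      then show ?thesis using c by (simp add: less_eq_v_def)
    qed
    then show ?thesis using h(1) by blast
  qed
  obtain g where g: "g \<in> K" using K(2) by (auto simp: directed_def)
  obtain h h' where h: "h \<in> K" "\<forall>x\<in>X. x \<notin> W h \<longrightarrow> snd (g x) = VL"
    and h': "h' \<in> K" "\<forall>x\<in>X. x \<notin> W h' \<longrightarrow> snd (g x) = VR"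
    using escape[OF g, of VL] escape[OF g, of VR] by auto
  obtain k where k: "k \<in> K" "h \<le> k" "h' \<le> k" using K(2) h(1) h'(1) unfolding directed_def by blast
  \<comment> \<open>A point outside \<open>W k\<close> is outside both \<open>W h\<close> and
    \<open>W h'\<close>, where the second component of \<open>g\<close> would be \<open>VL\<close>
    and \<open>VR\<close> at once.\<close>
  have "x \<in> W k" if "x \<in> X" for x
  proof (rule ccontr)
    assume "x \<notin> W k"
    then have "x \<notin> W h" "x \<notin> W h'" using W_mono k by blast+
    then have "snd (g x) = VL" "snd (g x) = VR" using h(2) h'(2) that by blast+
    then show False by simp
  qed
  then have nt: "\<exists>p\<in>\<pi> k x. p \<noteq> PBot" if "x \<in> X" for x using that by (auto simp: W_def \<pi>_def)
  show ?thesis by (rule rb_domain_approximations[OF G Union bounded imageI[OF k(1)] nt])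
qed

end

theorem theorem3p13:
  fixes X :: "'a::order set"
  assumes "is_domain X" and "countably_based X"
  shows "(rb_domain X \<longleftrightarrow> continuous_dcpo (scott_maps X A_omega)) \<and>
         (pointed X \<longrightarrow> (rb_domain X \<longleftrightarrow> continuous_dcpo (scott_maps X U_omega)))"
proof -
  obtain B where "countable B" "is_basis X B" using assms(2) by (auto simp: countably_based_def)
  then interpret countable_basis_domain X B using assms(1) by (simp add: countable_basis_domain_def)
  show ?thesis
    by (intro conjI impI iffI)
      (rule continuous_scott_maps_rb_domain, assumption, rule is_domain_A_omega, erule rb_domain_if_continuous_A_omega,
       rule continuous_scott_maps_rb_domain, assumption, rule is_domain_U_omega,
       rule rb_domain_if_continuous_U_omega)
qed

end
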